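(* Let $m$ be a positive integer with $a(m)\equiv0\pmod 8$. Write the prime factorization of $4m+1$ as $4m+1=\prod_{i=1}^{u}h_i\prod_{j=1}^{v}g_j^{\alpha_j}$, where the $h_i$ are the primes dividing $4m+1$ exactly once and the $g_j$ are the primes dividing it with exponent $\alpha_j\ge2$. Then for every integer $n\ge1$ with $\gcd\!\left(n,\,2\prod_{j=1}^{v}g_j^{\alpha_j}\right)=1$, $$b\!\left(18mn^2+\frac{9n^2-1}{2}\right)\equiv 0\pmod{72}.$$
   Context: The mock theta function $\mathcal{B}(q)=\sum_{n\ge0}\frac{q^n(-q;q^2)_n}{(q;q^2)_{n+1}}=\sum_{n\ge0}b(n)q^n$, $(a;q)_n=\prod_{j=0}^{n-1}(1-aq^j)$. The integers $a(n)$ are defined by $\sum_{n\ge0}a(n)q^n=f_1^4f_2$, where $f_m:=(q^m;q^m)_\infty$. *)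

theory Defs
  imports "HOL-Computational_Algebra.Computational_Algebra"
begin

text \<open>Summand of the mock theta function B(q), as a formal power series over the rationals:
  q^n (-q;q^2)_n / (q;q^2)_{n+1}.\<close>
definition B_term :: "nat \<Rightarrow> rat fps" where
  "B_term n = fps_X ^ n * (\<Prod>j<n. 1 + fps_X ^ (2*j+1))
                * inverse (\<Prod>j<Suc n. 1 - fps_X ^ (2*j+1))"

text \<open>b(N): coefficient of q^N in B(q). The summand with index n has order at least n,
  so only the summands n \<le> N contribute to the coefficient of q^N.\<close>
definition b_coeff :: "nat \<Rightarrow> rat" where
  "b_coeff N = fps_nth (\<Sum>n\<le>N. B_term n) N"

text \<open>Truncation of f_m = (q^m;q^m)_\<infinity> to factors k \<le> K (exact modulo q^{K+1}).\<close>
definition f_trunc :: "nat \<Rightarrow> nat \<Rightarrow> int fps" where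
  "f_trunc m K = (\<Prod>k\<in>{1..K}. 1 - fps_X ^ (m*k))"

definition a_coeff :: "nat \<Rightarrow> int" where
  "a_coeff N = fps_nth (f_trunc 1 N ^ 4 * f_trunc 2 N) N"

definition powerful_part :: "nat \<Rightarrow> nat" where
  "powerful_part k = (\<Prod>p\<in>{p\<in>prime_factors k. multiplicity p k \<ge> 2}. p ^ multiplicity p k)"

end

theory Submission
  imports Defs
begin

text \<open>
  The sum \<open>B(q) + B(-q)\<close> is a bilateral \<open>1\<psi>1\<close> series, and Ramanujan's summation gives
  \<open>\<Sum> b(2n) q^n = f_2^5 / f_1^4\<close>. Write \<open>\<phi> = f_1^2 / f_2\<close>, \<open>\<psi> = f_2^2 / f_1\<close>; by the Jacobi
  triple product these and \<open>f_1^3\<close> are theta series. With \<open>C = \<Sum> b(2n) q^n\<close> we have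
  \<open>C \<phi>^2 = f_2^3 = \<phi> \<psi>^2\<close> and \<open>\<Sum> a(n) q^n = \<phi>^2 f_2^3\<close>. The coefficient in question is the one
  of \<open>q^M\<close> in \<open>C\<close>, where \<open>4M + 1 = (3n)^2 (4m + 1)\<close>; in particular \<open>M = 2\<close> modulo 3.

  Modulo 9: the 3-dissection of \<open>C = \<psi>^2 / \<phi>\<close> shows that 9 divides every coefficient of \<open>C\<close> whose
  index is 2 modulo 3.

  Modulo 8: \<open>\<phi>^2 = 1 + 4 v\<close>, so for \<open>D = 4M + 1\<close> not a square both \<open>a(M)\<close> and \<open>b(2M)\<close> are
  4 times the coefficient of \<open>q^M\<close> in \<open>f_2^3 v\<close>. If \<open>D = 1\<close> modulo 8 this coefficient is even,
  because modulo 2 the series \<open>v\<close> is the logarithmic derivative of \<open>\<psi>\<close>. If \<open>D = 5\<close> modulo 8 it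
  counts solutions of \<open>x^2 + 4 y^2 = D\<close>, and Zagier's involution shows that it has the parity
  of half the number of divisors of \<open>D\<close>. That parity survives the factor \<open>(3n)^2\<close> under the
  coprimality hypothesis.
\<close>

unbundle fps_syntax

declare [[simproc del: poly_fps_eq]]
  \<comment> \<open>It turns equations between polynomials in \<open>fps_X\<close> into equations of type \<open>poly\<close>,
    on which ring normalisation gets stuck.\<close>

section \<open>Limits of formal power series\<close>

text \<open>Formal power series offer only coefficientwise stabilisation as a limit, so each product
  identity is proved for finite products, exactly or up to a multiple of \<open>fps_X ^ K\<close>,
  and then passed to the limit. This shapes the bilateral summation: the classical proof continues
  analytically in the parameter b, whereas here b = q^2 y with y a power of q, and a functional
  equation under y -> q^2 y links both y = q, the case wanted, and y = 1, where the negative half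
  vanishes, to the common value y = 0.

  The hypothesis on a(m) is used twice. Its parity alone shows that 4m + 1 is not a square, because
  the coefficient of q^m in f_2^3 is odd otherwise; this removes the term without the factor 4. What
  remains is the parity of one coefficient: for even m it is automatic, for odd m it concerns the
  divisors of 4m + 1 and has to be carried to (3n)^2 (4m + 1). The factor 3 puts M into the residue
  class needed for 9.\<close>

lemma X_power_dvd_iff:
  fixes f :: "'a::comm_ring_1 fps"
  shows "fps_X ^ k dvd f \<longleftrightarrow> (\<forall>i<k. f $ i = 0)"
proof
  assume "fps_X ^ k dvd f"
  then obtain g where "f = fps_X ^ k * g" by (rule dvdE)
  then show "\<forall>i<k. f $ i = 0" by (simp add: fps_X_power_mult_nth)
next
  assume *: "\<forall>i<k. f $ i = 0"
  have "f = fps_X ^ k * Abs_fps (\<lambda>i. f $ (i + k))"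
    using * by (auto simp: fps_eq_iff fps_X_power_mult_nth)
  then show "fps_X ^ k dvd f" by (rule dvdI)
qed

lemma X_power_dvd_mono:
  fixes f :: "'a::comm_ring_1 fps"
  assumes "fps_X ^ k dvd f" "j \<le> k"
  shows "fps_X ^ j dvd f"
  using assms by (auto simp: X_power_dvd_iff)

lemma tendsto_add_fps:
  fixes f g :: "'b \<Rightarrow> 'a::comm_ring_1 fps"
  assumes "(f \<longlongrightarrow> a) F" "(g \<longlongrightarrow> b) F"
  shows "((\<lambda>x. f x + g x) \<longlongrightarrow> a + b) F"
  unfolding tendsto_fps_iff
proof
  fix n
  have "eventually (\<lambda>x. f x $ n = a $ n) F" "eventually (\<lambda>x. g x $ n = b $ n) F"
    using assms by (auto simp: tendsto_fps_iff)
  then show "eventually (\<lambda>x. (f x + g x) $ n = (a + b) $ n) F"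
    by eventually_elim simp
qed

lemma tendsto_mult_fps:
  fixes f g :: "'b \<Rightarrow> 'a::comm_ring_1 fps"
  assumes "(f \<longlongrightarrow> a) F" "(g \<longlongrightarrow> b) F"
  shows "((\<lambda>x. f x * g x) \<longlongrightarrow> a * b) F"
  unfolding tendsto_fps_iff
proof
  fix n
  have "eventually (\<lambda>x. \<forall>i\<in>{..n}. f x $ i = a $ i) F"
       "eventually (\<lambda>x. \<forall>i\<in>{..n}. g x $ i = b $ i) F"
    using assms by (auto simp: tendsto_fps_iff intro!: eventually_ball_finite)
  then show "eventually (\<lambda>x. (f x * g x) $ n = (a * b) $ n) F"
    by eventually_elim (auto simp: fps_mult_nth intro!: sum.cong)
qed

lemma tendsto_power_fps:
  fixes f :: "'b \<Rightarrow> 'a::comm_ring_1 fps"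
  assumes "(f \<longlongrightarrow> a) F"
  shows "((\<lambda>x. f x ^ k) \<longlongrightarrow> a ^ k) F"
  by (induction k) (auto intro!: tendsto_mult_fps assms)

text \<open>Beyond n = k + c the congruence pins down the coefficient k on both sides. This is how
  finite identities with an error of growing order become identities of series.\<close>

lemma LIMSEQ_unique_fps_dvd:
  fixes f g :: "nat \<Rightarrow> 'a::comm_ring_1 fps"
  assumes "f \<longlonglongrightarrow> a" "g \<longlonglongrightarrow> b" "\<And>n. fps_X ^ (n - c) dvd f n - g n"
  shows "a = b"
proof (rule fps_ext)
  fix k
  have "eventually (\<lambda>n. f n $ k = a $ k) sequentially" "eventually (\<lambda>n. g n $ k = b $ k) sequentially"
    using assms by (auto simp: tendsto_fps_iff)
  then have "eventually (\<lambda>n::nat. a $ k = b $ k) sequentially"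
    using eventually_gt_at_top[of "k + c"]
  proof eventually_elim
    case (elim n)
    then show ?case using assms(3)[of n] by (simp add: X_power_dvd_iff)
  qed
  then show "a $ k = b $ k" by simp
qed

lemma LIMSEQ_unique_fps:
  fixes f :: "nat \<Rightarrow> 'a::comm_ring_1 fps"
  assumes "f \<longlonglongrightarrow> a" "f \<longlonglongrightarrow> b"
  shows "a = b"
  by (rule LIMSEQ_unique_fps_dvd[OF assms, of 0]) simp

definition euler_fin :: "nat \<Rightarrow> nat \<Rightarrow> 'a::comm_ring_1 fps" where
  "euler_fin m K = (\<Prod>k\<in>{1..K}. 1 - fps_X ^ (m * k))"

text \<open>The infinite product f_m, read off on the diagonal: for m > 0 the factors beyond k = N
  cannot reach q^N. The coefficient ring stays general because the bilateral series needs rationals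
  and the congruences need integers.\<close>

definition euler :: "nat \<Rightarrow> 'a::comm_ring_1 fps" where
  "euler m = Abs_fps (\<lambda>N. euler_fin m N $ N)"

lemma euler_fin_0 [simp]: "euler_fin m 0 = 1"
  by (simp add: euler_fin_def)

lemma euler_fin_Suc: "euler_fin m (Suc K) = euler_fin m K * (1 - fps_X ^ (m * Suc K))"
  by (simp add: euler_fin_def)

lemma euler_fin_cong:
  assumes "K \<le> L"
  shows "fps_X ^ (m * Suc K) dvd euler_fin m K - (euler_fin m L :: 'a::comm_ring_1 fps)"
  using assms
proof (induction L rule: dec_induct)
  case base
  then show ?case by simp
next
  case (step L)
  have "euler_fin m K - (euler_fin m (Suc L) :: 'a fps) =
      (euler_fin m K - euler_fin m L) + fps_X ^ (m * Suc L) * euler_fin m L"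
    by (simp add: euler_fin_Suc algebra_simps)
  moreover have "(fps_X :: 'a fps) ^ (m * Suc K) dvd fps_X ^ (m * Suc L)"
    using step by (intro le_imp_power_dvd) auto
  ultimately show ?case using step.IH by (metis dvd_add dvd_mult2)
qed

lemma euler_fin_nth_eq:
  assumes "m > 0" "n \<le> K"
  shows "euler_fin m K $ n = (euler m :: 'a::comm_ring_1 fps) $ n"
proof -
  have "n < m * Suc n" using assms by (cases m) auto
  then show ?thesis
    using euler_fin_cong[of n K m, where 'a='a] assms by (auto simp: X_power_dvd_iff euler_def)
qed

lemma euler_tendsto:
  assumes "m > 0" "filterlim h at_top F"
  shows "((\<lambda>x. euler_fin m (h x)) \<longlongrightarrow> (euler m :: 'a::comm_ring_1 fps)) F"
  unfolding tendsto_fps_iff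
proof
  fix n
  have "eventually (\<lambda>x. n \<le> h x) F"
    using assms(2) by (simp add: filterlim_at_top)
  then show "eventually (\<lambda>x. euler_fin m (h x) $ n = (euler m :: 'a fps) $ n) F"
    by eventually_elim (simp add: euler_fin_nth_eq assms)
qed

lemma euler_fin_nth_0: "m > 0 \<Longrightarrow> euler_fin m K $ 0 = 1"
  by (induction K) (auto simp: euler_fin_Suc)

lemma euler_nonzero: "euler m \<noteq> (0 :: 'a::comm_ring_1 fps)"
proof -
  have "euler m $ 0 = (1::'a)"
    by (simp add: euler_def)
  then show ?thesis by auto
qed

text \<open>Encodes the series of the c k q^(e k). Cutting the sum at k \<le> N makes it finite and
  loses nothing as long as k \<le> e k, which holds for square and triangular exponents
  alike.\<close>

definition sparse :: "(nat \<Rightarrow> 'a::comm_ring_1) \<Rightarrow> (nat \<Rightarrow> nat) \<Rightarrow> 'a fps" where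
  "sparse c e = Abs_fps (\<lambda>N. \<Sum>k\<le>N. if e k = N then c k else 0)"

lemma sparse_tendsto:
  assumes "\<And>k. k \<le> e k"
  shows "(\<lambda>n. \<Sum>k<n. fps_const (c k) * fps_X ^ e k) \<longlonglongrightarrow> sparse c e"
proof (rule tendsto_fpsI)
  fix N
  have "(\<Sum>k<n. fps_const (c k) * fps_X ^ e k) $ N = sparse c e $ N" if "n > N" for n
  proof -
    have "(\<Sum>k<n. fps_const (c k) * fps_X ^ e k) $ N = (\<Sum>k<n. if e k = N then c k else 0)"
      by (auto simp: fps_sum_nth fps_X_power_nth intro!: sum.cong)
    also have "\<dots> = (\<Sum>k\<le>N. if e k = N then c k else 0)"
    proof (intro sum.mono_neutral_right ballI)
      fix k assume "k \<in> {..<n} - {..N}"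
      then show "(if e k = N then c k else 0) = 0" using assms[of k] by auto
    qed (use that in auto)
    finally show ?thesis by (simp add: sparse_def)
  qed
  then show "eventually (\<lambda>n. (\<Sum>k<n. fps_const (c k) * fps_X ^ e k) $ N = sparse c e $ N) sequentially"
    by (intro eventually_mono[OF eventually_gt_at_top[of N]])
qed

lemma sparse_nth:
  assumes "inj e" "\<And>k. k \<le> e k"
  shows "sparse c e $ e k = c k"
proof -
  have "sparse c e $ e k = (\<Sum>j\<in>{k}. if e j = e k then c j else 0)"
    unfolding sparse_def fps_nth_Abs_fps
    using assms by (intro sum.mono_neutral_right) (auto dest: injD)
  then show ?thesis by simp
qed

lemma sparse_nth_0:
  assumes "N \<notin> range e"
  shows "sparse c e $ N = 0"
  using assms unfolding sparse_def by (auto intro!: sum.neutral)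

section \<open>The triple product\<close>

text \<open>Gaussian binomial coefficients. The q-Pascal rule needs no division, so q may lie in any
  commutative ring; constant polynomials \<open>[:q:]\<close> occur as well.\<close>

fun qbin :: "'a::comm_ring_1 \<Rightarrow> nat \<Rightarrow> nat \<Rightarrow> 'a" where
  "qbin q n 0 = 1"
| "qbin q 0 (Suc k) = 0"
| "qbin q (Suc n) (Suc k) = qbin q n k + q ^ Suc k * qbin q n (Suc k)"

lemma qbin_eq_0: "n < k \<Longrightarrow> qbin q n k = 0"
  by (induction q n k rule: qbin.induct) auto

lemma choose_two_Suc: "Suc k choose 2 = (k choose 2) + k"
  by (simp add: numeral_2_eq_2)

lemma two_choose_two: "2 * int (k choose 2) = int k * (int k - 1)"
  by (induction k) (auto simp: choose_two_Suc algebra_simps)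

lemma zero_choose_two [simp]: "0 choose 2 = 0"
  by (simp add: numeral_2_eq_2)

text \<open>Induction splits off the factor j = 0 and replaces z by zq. The form homogeneous in y
  and z allows y = q^n later, which centres the product without negative powers.\<close>

lemma q_binomial_theorem:
  fixes q y z :: "'a::comm_ring_1"
  shows "(\<Prod>j<N. y + z * q ^ j) =
    (\<Sum>k\<le>N. q ^ (k choose 2) * qbin q N k * z ^ k * y ^ (N - k))"
proof (induction N arbitrary: z)
  case 0
  then show ?case by simp
next
  case (Suc N)
  let ?a = "\<lambda>k. q ^ (k choose 2)"
  have "(\<Prod>j<Suc N. y + z * q ^ j) = (y + z) * (\<Prod>j<N. y + (z * q) * q ^ j)"
    by (simp only: prod.lessThan_Suc_shift) (simp add: mult_ac)
  also have "\<dots> = (y + z) * (\<Sum>k\<le>N. ?a k * qbin q N k * (z * q) ^ k * y ^ (N - k))"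
    by (simp only: Suc.IH)
  also have "\<dots> = (\<Sum>k\<le>N. y * (?a k * qbin q N k * (z * q) ^ k * y ^ (N - k)))
                  + (\<Sum>k\<le>N. z * (?a k * qbin q N k * (z * q) ^ k * y ^ (N - k)))"
    by (subst distrib_right) (simp only: sum_distrib_left)
  also have "(\<Sum>k\<le>N. y * (?a k * qbin q N k * (z * q) ^ k * y ^ (N - k))) =
      (\<Sum>k\<le>N. ?a k * qbin q N k * (z * q) ^ k * y ^ (Suc N - k))"
    by (intro sum.cong refl) (simp add: Suc_diff_le mult_ac)
  also have "\<dots> = (\<Sum>k\<le>Suc N. ?a k * qbin q N k * (z * q) ^ k * y ^ (Suc N - k))"
    by (simp add: qbin_eq_0)
  also have "\<dots> + (\<Sum>k\<le>N. z * (?a k * qbin q N k * (z * q) ^ k * y ^ (N - k)))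
      = y ^ Suc N + (\<Sum>k\<le>N. ?a (Suc k) * qbin q N (Suc k) * (z * q) ^ Suc k * y ^ (N - k)
                             + z * (?a k * qbin q N k * (z * q) ^ k * y ^ (N - k)))"
    by (subst sum.atMost_Suc_shift) (simp only: sum.distrib, simp)
  \<comment> \<open>Both summands carry q^((k+1) choose 2); what is left is the q-Pascal
    rule.\<close>
  also have "(\<Sum>k\<le>N. ?a (Suc k) * qbin q N (Suc k) * (z * q) ^ Suc k * y ^ (N - k)
                             + z * (?a k * qbin q N k * (z * q) ^ k * y ^ (N - k))) =
      (\<Sum>k\<le>N. ?a (Suc k) * qbin q (Suc N) (Suc k) * z ^ Suc k * y ^ (N - k))"
    by (intro sum.cong refl, simp only: choose_two_Suc)
       (simp add: algebra_simps power_add power_mult_distrib)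
  also have "y ^ Suc N + \<dots> =
      (\<Sum>k\<le>Suc N. ?a k * qbin q (Suc N) k * z ^ k * y ^ (Suc N - k))"
    by (subst sum.atMost_Suc_shift) simp
  finally show ?case .
qed

text \<open>The exponent i(i-1)/2 of the triple product for an integer index; it is never negative,
  so \<open>nat\<close> loses nothing.\<close>

definition ztri :: "int \<Rightarrow> nat" where
  "ztri i = nat (i * (i - 1) div 2)"

lemma two_ztri: "2 * int (ztri i) = i * (i - 1)"
proof -
  have "even (i * (i - 1))" by simp
  moreover have "i * (i - 1) \<ge> 0"
    by (cases "i \<ge> 1") (auto intro: mult_nonneg_nonneg mult_nonpos_nonpos)
  ultimately show ?thesis by (auto simp: ztri_def elim!: evenE)
qed

lemma ztri_shift:
  assumes "k \<le> 2 * n"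
  shows "ztri (int k - int n) + n * k = (k choose 2) + (Suc n choose 2)"
proof -
  have "2 * (int (ztri (int k - int n) + n * k)) = 2 * int ((k choose 2) + (Suc n choose 2))"
    using two_choose_two[of k] two_choose_two[of "Suc n"] two_ztri[of "int k - int n"]
    by (simp add: algebra_simps)
  then show ?thesis by (simp only: mult_cancel_left of_nat_eq_iff) simp
qed

text \<open>The q-binomial theorem of order 2n with y = q^n: the factors with j < n become q^j (z +
  q^(n-j)), those with j \<ge> n become q^n (1 + z q^(j-n)), and the common power of q cancels.
  Writing z + q^(j+1) for z (1 + q^(j+1) / z) multiplies the usual identity by z^n and keeps all
  exponents of z non-negative.\<close>

theorem jacobi_triple_finite:
  fixes q z :: "'a::idom"
  assumes "q \<noteq> 0"
  shows "(\<Prod>j<n. (1 + z * q ^ j) * (z + q ^ Suc j)) =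
         (\<Sum>k\<le>2 * n. q ^ ztri (int k - int n) * qbin q (2 * n) k * z ^ k)"
proof -
  let ?e = "n * n + (n choose 2)"
  have split: "{..<2 * n} = {..<n} \<union> {n..<2 * n}" "{..<n} \<inter> {n..<2 * n} = {}" by auto
  have "(\<Prod>j<2 * n. q ^ n + z * q ^ j) =
      (\<Prod>j<n. q ^ n + z * q ^ j) * (\<Prod>j=n..<2 * n. q ^ n + z * q ^ j)"
    unfolding split(1) by (intro prod.union_disjoint) auto
  also have "(\<Prod>j=n..<2 * n. q ^ n + z * q ^ j) = (\<Prod>j<n. q ^ n * (1 + z * q ^ j))"
    by (rule prod.reindex_bij_witness[of _ "\<lambda>j. j + n" "\<lambda>j. j - n"])
       (auto simp: algebra_simps simp flip: power_add)
  also have "\<dots> = q ^ (n * n) * (\<Prod>j<n. 1 + z * q ^ j)"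
    by (simp add: prod.distrib power_mult)
  also have "(\<Prod>j<n. q ^ n + z * q ^ j) = (\<Prod>j<n. q ^ j * (z + q ^ (n - j)))"
    by (intro prod.cong refl) (auto simp: algebra_simps simp flip: power_add)
  also have "\<dots> = q ^ (n choose 2) * (\<Prod>j<n. z + q ^ (n - j))"
  proof -
    have "(\<Prod>j<n. q ^ j) = q ^ (n choose 2)"
      by (induction n) (simp_all add: choose_two_Suc power_add)
    then show ?thesis by (simp add: prod.distrib)
  qed
  also have "(\<Prod>j<n. z + q ^ (n - j)) = (\<Prod>j<n. z + q ^ Suc j)"
    by (rule prod.reindex_bij_witness[of _ "\<lambda>j. n - Suc j" "\<lambda>j. n - Suc j"])
       (auto simp: Suc_diff_Suc simp del: power_Suc)
  finally have lhs: "(\<Prod>j<2 * n. q ^ n + z * q ^ j) =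
      q ^ ?e * (\<Prod>j<n. (1 + z * q ^ j) * (z + q ^ Suc j))"
    by (simp add: prod.distrib power_add mult_ac)
  have "(\<Prod>j<2 * n. q ^ n + z * q ^ j) =
      (\<Sum>k\<le>2 * n. q ^ (k choose 2) * qbin q (2 * n) k * z ^ k * (q ^ n) ^ (2 * n - k))"
    by (rule q_binomial_theorem)
  also have "\<dots> = (\<Sum>k\<le>2 * n. q ^ ?e * (q ^ ztri (int k - int n) * qbin q (2 * n) k * z ^ k))"
  proof (intro sum.cong refl)
    fix k assume "k \<in> {..2 * n}"
    then have k: "k \<le> 2 * n" by simp
    have "int ((Suc n choose 2) + (n choose 2)) = int (n * n)"
      using two_choose_two[of n] two_choose_two[of "Suc n"] by (simp add: algebra_simps)
    then have "(Suc n choose 2) + (n choose 2) = n * n" by (simp only: of_nat_eq_iff)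
    moreover have "n * (2 * n - k) + n * k = n * n + n * n"
      using k by (metis add_mult_distrib2 le_add_diff_inverse2 mult_2)
    ultimately have "(k choose 2) + n * (2 * n - k) = ?e + ztri (int k - int n)"
      using ztri_shift[OF k] by linarith
    then have "q ^ (k choose 2) * (q ^ n) ^ (2 * n - k) = q ^ ?e * q ^ ztri (int k - int n)"
      by (simp only: power_mult[symmetric] power_add[symmetric])
    then show "q ^ (k choose 2) * qbin q (2 * n) k * z ^ k * (q ^ n) ^ (2 * n - k) =
        q ^ ?e * (q ^ ztri (int k - int n) * qbin q (2 * n) k * z ^ k)"
      by (simp add: mult_ac)
  qed
  finally have "q ^ ?e * (\<Prod>j<n. (1 + z * q ^ j) * (z + q ^ Suc j)) = q ^ ?e *
      (\<Sum>k\<le>2 * n. q ^ ztri (int k - int n) * qbin q (2 * n) k * z ^ k)"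
    by (simp only: lhs sum_distrib_left)
  then show ?thesis using assms by simp
qed

lemma X_power_dvd_cancel_unit:
  fixes f u :: "'a::comm_ring_1 fps"
  assumes "fps_X ^ t dvd f * u" "u $ 0 = 1"
  shows "fps_X ^ t dvd f"
proof -
  have "f $ i = 0" if "i < t" for i
    using that
  proof (induction i rule: less_induct)
    case (less i)
    have "0 = (f * u) $ i" using assms(1) less.prems by (simp add: X_power_dvd_iff)
    also have "\<dots> = (\<Sum>j\<in>{i}. f $ j * u $ (i - j))"
      unfolding fps_mult_nth using less by (intro sum.mono_neutral_right) auto
    finally show ?case using assms(2) by simp
  qed
  then show ?thesis by (simp add: X_power_dvd_iff)
qed

text \<open>The quotient formula for Gaussian binomials, cleared of denominators. With Q = q^m the
  Pascal step rests on 1 - Q^(n+1) = (1 - Q^(k+1)) + Q^(k+1) (1 - Q^(n-k)).\<close>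

lemma qbin_X_euler_fin:
  assumes "k \<le> N"
  shows "qbin (fps_X ^ m) N k * euler_fin m k * euler_fin m (N - k) = (euler_fin m N :: 'a::comm_ring_1 fps)"
  using assms
proof (induction "fps_X ^ m :: 'a fps" N k rule: qbin.induct)
  case (3 n k)
  let ?q = "\<lambda>j. fps_X ^ (m * j) :: 'a fps" and ?E = "euler_fin m :: nat \<Rightarrow> 'a fps"
  have IH1: "qbin (fps_X ^ m) n k * ?E k * ?E (n - k) = ?E n"
    using 3 by simp
  have pow: "(fps_X ^ m) ^ Suc k = ?q (Suc k)" by (simp only: power_mult)
  have "qbin (fps_X ^ m) n (Suc k) * ?E (Suc k) * ?E (n - k) = ?E n * (1 - ?q (n - k))"
  proof (cases "k = n")
    case True
    then show ?thesis by (simp add: qbin_eq_0)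
  next
    case False
    then have "qbin (fps_X ^ m) n (Suc k) * ?E (Suc k) * ?E (n - Suc k) = ?E n"
      using 3 by simp
    moreover have "n - k = Suc (n - Suc k)" using 3(3) False by simp
    moreover have "?E (n - k) = ?E (n - Suc k) * (1 - ?q (n - k))"
      using calculation(2) euler_fin_Suc[of m "n - Suc k"] by simp
    ultimately show ?thesis by (simp only: mult.assoc[symmetric])
  qed
  moreover have "qbin (fps_X ^ m) n k * ?E (Suc k) * ?E (n - k) = ?E n * (1 - ?q (Suc k))"
    unfolding IH1[symmetric] by (simp only: euler_fin_Suc) (simp add: mult_ac)
  moreover have "?q (Suc k) * ?q (n - k) = ?q (Suc n)"
    using 3(3) by (simp flip: power_add add_mult_distrib2)
  moreover have "?E (Suc n) = ?E n * (1 - ?q (Suc n))"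
    by (rule euler_fin_Suc)
  ultimately have *: "qbin (fps_X ^ m) n k * ?E (Suc k) * ?E (n - k) = ?E n * (1 - ?q (Suc k))"
      "qbin (fps_X ^ m) n (Suc k) * ?E (Suc k) * ?E (n - k) = ?E n * (1 - ?q (n - k))"
      "?E (Suc n) = ?E n * (1 - ?q (Suc k) * ?q (n - k))"
    by simp_all
  have "(qbin (fps_X ^ m) n k + ?q (Suc k) * qbin (fps_X ^ m) n (Suc k)) * ?E (Suc k) * ?E (n - k) =
      qbin (fps_X ^ m) n k * ?E (Suc k) * ?E (n - k) +
      ?q (Suc k) * (qbin (fps_X ^ m) n (Suc k) * ?E (Suc k) * ?E (n - k))"
    by (simp only: distrib_left distrib_right mult.assoc)
  also have "\<dots> = ?E (Suc n)"
    unfolding * by (simp only: right_diff_distrib mult.left_commute mult_1_right) simp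
  finally show ?case
    unfolding qbin.simps pow diff_Suc_Suc .
qed auto

text \<open>By the quotient formula the product on the left is a ratio of truncations of f_m, all of
  length at least min k (2n - k), and such truncations agree up to that order.\<close>

lemma euler_fin_qbin_cong:
  assumes "k \<le> 2 * n" "m > 0"
  shows "fps_X ^ Suc (min k (2 * n - k)) dvd euler_fin m n * qbin (fps_X ^ m) (2 * n) k - (1 :: 'a::comm_ring_1 fps)"
proof -
  let ?E = "euler_fin m :: nat \<Rightarrow> 'a fps" and ?b = "2 * n - k" and ?m = "min k (2 * n - k)"
  have *: "fps_X ^ Suc ?m dvd ?E ?m - ?E L" if "?m \<le> L" for L
  proof (rule X_power_dvd_mono[OF euler_fin_cong[OF that]])
    show "Suc ?m \<le> m * Suc ?m" using assms(2) by (cases m) auto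
  qed
  \<comment> \<open>All products are compared with the square of the shortest truncation
    \<open>?E ?m\<close>; the intermediate terms cancel.\<close>
  have "fps_X ^ Suc ?m dvd (?E ?m - ?E k) * ?E ?m + ?E k * (?E ?m - ?E ?b)
      - (?E ?m - ?E n) * ?E ?m - ?E n * (?E ?m - ?E (2 * n))"
    by (intro dvd_add dvd_diff dvd_mult dvd_mult2 *) auto
  also have "\<dots> = ?E n * ?E (2 * n) - ?E k * ?E ?b" by (simp add: algebra_simps)
  also have "\<dots> = (?E n * qbin (fps_X ^ m) (2 * n) k - 1) * (?E k * ?E ?b)"
    unfolding qbin_X_euler_fin[OF assms(1), symmetric] by (simp add: algebra_simps)
  finally show ?thesis
    by (rule X_power_dvd_cancel_unit) (simp add: euler_fin_nth_0 assms)
qed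

section \<open>Passage to the limit in the triple product\<close>

lemma tendsto_fps_transform:
  fixes f g :: "nat \<Rightarrow> 'a::comm_ring_1 fps"
  assumes "f \<longlonglongrightarrow> a" "\<And>n. fps_X ^ (n - c) dvd g n - f n"
  shows "g \<longlonglongrightarrow> a"
proof (rule tendsto_fpsI)
  fix k
  have "eventually (\<lambda>n. f n $ k = a $ k) sequentially"
    using assms by (auto simp: tendsto_fps_iff)
  then show "eventually (\<lambda>n::nat. g n $ k = a $ k) sequentially"
    using eventually_gt_at_top[of "k + c"]
  proof eventually_elim
    case (elim n)
    then show ?case using assms(2)[of n] by (simp add: X_power_dvd_iff)
  qed
qed

text \<open>The Gaussian weight differs from 1 only from order n - |i| + 1 on, and the term of index
  i has order at least |i| - c, so the total error has order at least n - c. Triangular exponents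
  need c = 1, since they vanish at i = 1 as well as at i = 0.\<close>

lemma jacobi_triple_limit:
  fixes g :: "int \<Rightarrow> 'a::comm_ring_1 fps"
  assumes "m > 0" and g: "\<And>i. fps_X ^ (nat \<bar>i\<bar> - c) dvd g i"
    and "(\<lambda>n. \<Sum>k\<le>2 * n. g (int k - int n)) \<longlonglongrightarrow> G"
  shows "(\<lambda>n. \<Sum>k\<le>2 * n. euler_fin m n * qbin (fps_X ^ m) (2 * n) k * g (int k - int n)) \<longlonglongrightarrow> G"
  using assms(3)
proof (rule tendsto_fps_transform[where c = c])
  fix n
  have "fps_X ^ (n - c) dvd (euler_fin m n * qbin (fps_X ^ m) (2 * n) k - 1) * g (int k - int n)"
    if "k \<le> 2 * n" for k
  proof -
    have "fps_X ^ (Suc (min k (2 * n - k)) + (nat \<bar>int k - int n\<bar> - c)) dvd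
        (euler_fin m n * qbin (fps_X ^ m) (2 * n) k - 1) * g (int k - int n)"
      unfolding power_add by (intro mult_dvd_mono euler_fin_qbin_cong that assms)
    then show ?thesis
      by (rule X_power_dvd_mono) (use that in auto)
  qed
  then show "fps_X ^ (n - c) dvd
      (\<Sum>k\<le>2 * n. euler_fin m n * qbin (fps_X ^ m) (2 * n) k * g (int k - int n)) -
      (\<Sum>k\<le>2 * n. g (int k - int n))"
    unfolding sum_subtractf[symmetric] by (intro dvd_sum) (simp add: algebra_simps)
qed

lemma sum_symmetric_int:
  fixes g :: "int \<Rightarrow> 'a::comm_monoid_add"
  shows "(\<Sum>k\<le>2 * n. g (int k - int n)) = g 0 + (\<Sum>k<n. g (int (Suc k)) + g (- int (Suc k)))"
proof (induction n)
  case 0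
  then show ?case by simp
next
  case (Suc n)
  have "(\<Sum>k\<le>2 * Suc n. g (int k - int (Suc n))) =
      g (- int (Suc n)) + ((\<Sum>k\<le>2 * n. g (int k - int n)) + g (int (Suc n)))"
    by (simp only: mult_Suc_right add_2_eq_Suc sum.atMost_Suc_shift[of _ "Suc (2 * n)"]
        sum.atMost_Suc[of _ "2 * n"]) simp
  then show ?case unfolding Suc by (simp add: add_ac)
qed

section \<open>Theta series of Gauss and Jacobi\<close>

definition sq_theta :: "int fps" where
  "sq_theta = sparse (\<lambda>k. (-1) ^ Suc k) (\<lambda>k. (Suc k)\<^sup>2)"

text \<open>Ramanujan's phi(-q). The factor 2 is kept visible because the arguments modulo 8 depend
  on it.\<close>

definition phi :: "int fps" where
  "phi = 1 + 2 * sq_theta"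

definition psi :: "int fps" where
  "psi = sparse (\<lambda>_. 1) (\<lambda>k. Suc k choose 2)"

definition jac :: "int fps" where
  "jac = sparse (\<lambda>k. (-1) ^ k * (2 * int k + 1)) (\<lambda>k. Suc k choose 2)"

lemma odd_prod_euler_fin:
  "(\<Prod>j<n. 1 - fps_X ^ (m * Suc (2 * j))) * euler_fin (2 * m) n = (euler_fin m (2 * n) :: 'a::comm_ring_1 fps)"
proof (induction n)
  case (Suc n)
  have "(euler_fin m (2 * Suc n) :: 'a fps) =
      euler_fin m (2 * n) * (1 - fps_X ^ (m * Suc (2 * n))) * (1 - fps_X ^ (2 * m * Suc n))"
    using euler_fin_Suc[of m "Suc (2 * n)", where 'a = 'a] euler_fin_Suc[of m "2 * n", where 'a = 'a]
    by (simp add: mult_ac)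
  then show ?case
    unfolding Suc.IH[symmetric] euler_fin_Suc prod.lessThan_Suc by (simp only: mult_ac)
qed auto

lemma euler_fin_plus:
  "(\<Prod>j<n. 1 + fps_X ^ (m * Suc j)) * euler_fin m n = (euler_fin (2 * m) n :: 'a::comm_ring_1 fps)"
proof (induction n)
  case (Suc n)
  have "(1 + fps_X ^ (m * Suc n)) * (1 - fps_X ^ (m * Suc n)) = (1 - fps_X ^ (2 * m * Suc n) :: 'a fps)"
    by (simp only: mult_2 mult.assoc power_add) (simp add: algebra_simps power_add)
  note * = this[symmetric]
  show ?case
    unfolding Suc.IH[symmetric] euler_fin_Suc prod.lessThan_Suc * by (simp only: mult_ac)
qed auto

lemma filterlim_twice: "filterlim (\<lambda>n::nat. 2 * n) at_top sequentially"
  by (rule filterlim_subseq) (auto simp: strict_mono_def)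

lemma le_square_Suc: "k \<le> (Suc k)\<^sup>2"
  by (simp add: power2_eq_square)

lemma le_choose_two: "k \<le> Suc k choose 2"
  by (simp add: choose_two_Suc)

lemma le_square_self: "(n::nat) \<le> n\<^sup>2"
  by (simp add: power2_eq_square)

lemma sq_theta_tendsto: "(\<lambda>n. \<Sum>k<n. fps_const ((-1) ^ Suc k) * fps_X ^ (Suc k)\<^sup>2) \<longlonglongrightarrow> sq_theta"
  unfolding sq_theta_def by (rule sparse_tendsto, rule le_square_Suc)

lemma fps_const_minus_one_power: "fps_const ((-1) ^ k) = (-1 :: 'a::comm_ring_1 fps) ^ k"
  by (simp add: minus_one_power_iff flip: fps_const_neg)

text \<open>Triple product with base q^2 and z = -q: the two factors of index j combine to -q (1 -
  q^(2j+1))^2.\<close>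

theorem gauss_square: "phi * euler 2 = euler 1 ^ 2"
proof -
  define g :: "int \<Rightarrow> int fps" where
    "g i = fps_const ((-1) ^ nat \<bar>i\<bar>) * fps_X ^ (nat \<bar>i\<bar>)\<^sup>2" for i
  let ?O = "\<lambda>n. \<Prod>j<n. 1 - fps_X ^ Suc (2 * j) :: int fps"
  have "(\<lambda>n. \<Sum>k\<le>2 * n. g (int k - int n)) \<longlonglongrightarrow> phi"
  proof -
    have "(\<Sum>k\<le>2 * n. g (int k - int n)) = 1 + 2 * (\<Sum>k<n. fps_const ((-1) ^ Suc k) * fps_X ^ (Suc k)\<^sup>2)" for n
      unfolding sum_symmetric_int sum_distrib_left
      by (auto simp: g_def nat_add_distrib intro!: sum.cong)
    then show ?thesis
      unfolding phi_def
      by (simp only:) (intro tendsto_add_fps tendsto_mult_fps tendsto_const sq_theta_tendsto)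
  qed
  moreover have "fps_X ^ (nat \<bar>i\<bar> - 0) dvd g i" for i
    unfolding g_def by (intro dvd_mult le_imp_power_dvd) (simp only: diff_zero le_square_self)
  ultimately have "(\<lambda>n. \<Sum>k\<le>2 * n. euler_fin 2 n * qbin (fps_X ^ 2) (2 * n) k * g (int k - int n)) \<longlonglongrightarrow> phi"
    by (intro jacobi_triple_limit[where c = 0]) auto
  moreover have "(\<Sum>k\<le>2 * n. euler_fin 2 n * qbin (fps_X ^ 2) (2 * n) k * g (int k - int n)) =
      euler_fin 2 n * ?O n ^ 2" for n
  proof -
    have "(-fps_X) ^ n * ?O n ^ 2 = (\<Prod>j<n. (1 + (- fps_X) * (fps_X ^ 2) ^ j) * (- fps_X + (fps_X ^ 2) ^ Suc j) :: int fps)"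
    proof -
      have "(1 + (- fps_X) * (fps_X ^ 2) ^ j) * (- fps_X + (fps_X ^ 2) ^ Suc j) =
          - fps_X * (1 - fps_X ^ Suc (2 * j) :: int fps) ^ 2" for j
        by (simp only: power2_eq_square power_mult_distrib mult_2 power_add power_Suc)
           (simp add: algebra_simps)
      then show ?thesis
        by (simp only: prod.distrib prod_power_distrib prod_constant card_lessThan)
    qed
    also have "\<dots> = (\<Sum>k\<le>2 * n. (fps_X ^ 2) ^ ztri (int k - int n) * qbin (fps_X ^ 2) (2 * n) k * (- fps_X) ^ k)"
      by (rule jacobi_triple_finite) simp
    also have "\<dots> = (\<Sum>k\<le>2 * n. (- fps_X) ^ n * (qbin (fps_X ^ 2) (2 * n) k * g (int k - int n)))"
    proof (intro sum.cong refl)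
      fix k
      let ?i = "int k - int n"
      \<comment> \<open>With i = k - n one has i (i - 1) + k = i^2 + n: the exponent becomes a
        square, and q^n matches the power split off on the left.\<close>
      have "int (2 * ztri ?i + k) = int ((nat \<bar>?i\<bar>)\<^sup>2 + n)"
        using two_ztri[of ?i] by (simp add: power2_eq_square algebra_simps)
      then have e: "2 * ztri ?i + k = (nat \<bar>?i\<bar>)\<^sup>2 + n" by (simp only: of_nat_eq_iff)
      have sg: "(-1) ^ k = (-1) ^ n * (-1 :: int fps) ^ nat \<bar>?i\<bar>"
      proof -
        have "even (n + nat \<bar>?i\<bar>) = even k" by (auto simp: even_nat_iff)
        then show ?thesis by (auto simp: minus_one_power_iff)
      qed
      have "(fps_X ^ 2) ^ ztri ?i * (- fps_X) ^ k = (-1) ^ k * (fps_X :: int fps) ^ (2 * ztri ?i + k)"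
        by (simp add: power_minus[of fps_X] power_add power_mult)
      also have "\<dots> = (- fps_X) ^ n * g ?i"
        unfolding e sg g_def
        by (simp add: power_minus[of fps_X] power_add mult_ac fps_const_minus_one_power)
      finally show "(fps_X ^ 2) ^ ztri ?i * qbin (fps_X ^ 2) (2 * n) k * (- fps_X) ^ k =
          (- fps_X) ^ n * (qbin (fps_X ^ 2) (2 * n) k * g ?i)"
        by (simp add: mult_ac)
    qed
    finally have "?O n ^ 2 = (\<Sum>k\<le>2 * n. qbin (fps_X ^ 2) (2 * n) k * g (int k - int n))"
      unfolding sum_distrib_left[symmetric] by simp
    then show ?thesis
      by (simp only: sum_distrib_left mult.assoc)
  qed
  ultimately have "(\<lambda>n. euler_fin 2 n * ?O n ^ 2) \<longlonglongrightarrow> phi" by (simp only:)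
  \<comment> \<open>The second factor f_2 is what completes both products over odd exponents to
    f_1.\<close>
  then have "(\<lambda>n. euler_fin 2 n * ?O n ^ 2 * euler_fin 2 n) \<longlonglongrightarrow> phi * euler 2"
    by (intro tendsto_mult_fps euler_tendsto filterlim_ident) auto
  moreover have "euler_fin 2 n * ?O n ^ 2 * euler_fin 2 n = euler_fin 1 (2 * n) ^ 2" for n
  proof -
    have *: "?O n * euler_fin 2 n = euler_fin 1 (2 * n)"
      using odd_prod_euler_fin[where m = 1 and n = n and 'a = int] by (simp only: mult_1 mult_1_right)
    show ?thesis unfolding *[symmetric] by (simp only: power2_eq_square mult_ac)
  qed
  moreover have "(\<lambda>n. euler_fin 1 (2 * n) ^ 2) \<longlonglongrightarrow> (euler 1 ^ 2 :: int fps)"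
    by (intro tendsto_power_fps euler_tendsto filterlim_twice) auto
  ultimately show ?thesis by (simp only: ) (rule LIMSEQ_unique_fps)
qed

lemma ztri_pos: "ztri (int (Suc k)) = Suc k choose 2"
  and ztri_neg: "ztri (- int (Suc k)) = Suc (Suc k) choose 2"
  using two_ztri[of "int (Suc k)"] two_ztri[of "- int (Suc k)"]
    two_choose_two[of "Suc k"] two_choose_two[of "Suc (Suc k)"] by (auto simp: algebra_simps)

lemma ztri_dvd: "fps_X ^ (nat \<bar>i\<bar> - 1) dvd (fps_X ^ ztri i :: 'a::comm_ring_1 fps)"
proof -
  have "0 \<le> (\<bar>i\<bar> - 1) * (\<bar>i\<bar> - 2)"
    by (cases "\<bar>i\<bar> \<le> 1") (auto intro: mult_nonpos_nonpos mult_nonneg_nonneg)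
  then have "int (nat \<bar>i\<bar> - 1) \<le> int (ztri i)"
    using two_ztri[of i] by (cases "i \<ge> 0") (auto simp: algebra_simps abs_if)
  then show ?thesis by (intro le_imp_power_dvd) simp
qed

text \<open>Triple product with base q and z = 1. The indices i and 1 - i share an exponent, so the
  sum tends to 2 psi; on the product side the factor 1 + q^0 supplies the other 2.\<close>

theorem gauss_triangular: "psi * euler 1 = euler 2 ^ 2"
proof -
  define g :: "int \<Rightarrow> int fps" where "g i = fps_X ^ ztri i" for i
  let ?A = "\<lambda>n. \<Prod>j<n. 1 + fps_X ^ Suc j :: int fps"
  have "(\<lambda>n. \<Sum>k\<le>2 * n. g (int k - int n)) \<longlonglongrightarrow> psi + psi"
  proof -
    let ?p = "\<lambda>n. \<Sum>k<n. fps_const 1 * fps_X ^ (Suc k choose 2) :: int fps"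
    have "(\<Sum>k\<le>2 * n. g (int k - int n)) = ?p n + ?p (Suc n)" for n
    proof -
      have "(\<Sum>k\<le>2 * n. g (int k - int n)) =
          1 + (\<Sum>k<n. fps_X ^ (Suc k choose 2) + fps_X ^ (Suc (Suc k) choose 2))"
        unfolding sum_symmetric_int by (simp only: g_def ztri_pos ztri_neg) (simp add: ztri_def)
      moreover have "?p (Suc n) = 1 + (\<Sum>k<n. fps_X ^ (Suc (Suc k) choose 2))"
        unfolding sum.lessThan_Suc_shift by (simp add: choose_two_Suc)
      ultimately show ?thesis by (simp add: sum.distrib)
    qed
    moreover have "?p \<longlonglongrightarrow> psi"
      unfolding psi_def by (rule sparse_tendsto, rule le_choose_two)
    ultimately show ?thesis
      by (simp only:) (intro tendsto_add_fps LIMSEQ_Suc)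
  qed
  moreover have "fps_X ^ (nat \<bar>i\<bar> - 1) dvd g i" for i
    unfolding g_def by (rule ztri_dvd)
  ultimately have "(\<lambda>n. \<Sum>k\<le>2 * n. euler_fin 1 n * qbin (fps_X ^ 1) (2 * n) k * g (int k - int n)) \<longlonglongrightarrow> psi + psi"
    by (intro jacobi_triple_limit[where c = 1]) auto
  moreover have "(\<Sum>k\<le>2 * n. euler_fin 1 n * qbin (fps_X ^ 1) (2 * n) k * g (int k - int n)) =
      euler_fin 1 n * (\<Prod>j<n. (1 + fps_X ^ j) * (1 + fps_X ^ Suc j))" for n
    using jacobi_triple_finite[of "fps_X :: int fps" 1 n]
    by (simp add: g_def sum_distrib_left mult_ac)
  ultimately have "(\<lambda>n. euler_fin 1 n * (\<Prod>j<n. (1 + fps_X ^ j) * (1 + fps_X ^ Suc j))) \<longlonglongrightarrow> psi + psi"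
    by (simp only:)
  moreover have "(\<lambda>n. 1 + fps_X ^ n :: int fps) \<longlonglongrightarrow> 1 + 0"
    by (intro tendsto_add_fps tendsto_const tendsto_fps_transform[where c = 0, OF tendsto_const]) simp
  \<comment> \<open>The factor 1 + q^n, which tends to 1, completes the shifted product of the 1 +
    q^j; with the second f_1, each product of the 1 + q^(j+1) turns an f_1 into f_2.\<close>
  ultimately have "(\<lambda>n. (euler_fin 1 n * (\<Prod>j<n. (1 + fps_X ^ j) * (1 + fps_X ^ Suc j))) *
      (euler_fin 1 n * (1 + fps_X ^ n))) \<longlonglongrightarrow> (psi + psi) * (euler 1 * (1 + 0))"
    by (intro tendsto_mult_fps euler_tendsto filterlim_ident) auto
  moreover have "(euler_fin 1 n * (\<Prod>j<n. (1 + fps_X ^ j) * (1 + fps_X ^ Suc j))) *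
      (euler_fin 1 n * (1 + fps_X ^ n)) = (2 * euler_fin 2 n ^ 2 :: int fps)" for n
  proof -
    have "(\<Prod>j<n. 1 + fps_X ^ j) * (1 + fps_X ^ n) = 2 * ?A n"
      using prod.lessThan_Suc_shift[of "\<lambda>j. 1 + fps_X ^ j :: int fps" n]
      by (simp only: prod.lessThan_Suc power_0 one_add_one)
    moreover have "(euler_fin 1 n * (\<Prod>j<n. (1 + fps_X ^ j) * (1 + fps_X ^ Suc j))) * (euler_fin 1 n * (1 + fps_X ^ n)) =
        euler_fin 1 n * euler_fin 1 n * ?A n * ((\<Prod>j<n. 1 + fps_X ^ j) * (1 + fps_X ^ n))"
      unfolding prod.distrib by (simp only: mult_ac)
    ultimately show ?thesis
      using euler_fin_plus[of 1 n, symmetric, where 'a = int]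
      by (simp only: power2_eq_square mult_1 mult_1_right mult_ac)
  qed
  moreover have "(\<lambda>n. 2 * euler_fin 2 n ^ 2) \<longlonglongrightarrow> (2 * euler 2 ^ 2 :: int fps)"
    by (intro tendsto_mult_fps tendsto_const tendsto_power_fps euler_tendsto filterlim_ident) auto
  ultimately have "(psi + psi) * (euler 1 * (1 + 0)) = 2 * euler 2 ^ 2"
    by (simp only: LIMSEQ_unique_fps)
  then have "2 * (psi * euler 1) = 2 * euler 2 ^ 2" by (simp add: algebra_simps)
  then show ?thesis by simp
qed

lemma qbin_const_poly: "qbin [:q:] n k = [:qbin q n k:]"
  by (induction q n k rule: qbin.induct) (auto simp: poly_const_pow)

lemma pderiv_sum: "pderiv (sum f A) = (\<Sum>x\<in>A. pderiv (f x) :: 'a::idom poly)"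
  by (induction A rule: infinite_finite_induct) (auto simp: pderiv_add)

lemma prod_linear_factors_fps:
  "(\<Prod>j<n. fps_X ^ Suc j - 1) = (-1) ^ n * (euler_fin 1 n :: int fps)"
  by (induction n) (simp_all add: euler_fin_Suc algebra_simps)

lemma prod_euler_fin_1: "(\<Prod>j<n. 1 - fps_X ^ Suc j) = (euler_fin 1 n :: int fps)"
  by (induction n) (simp_all add: euler_fin_Suc)

text \<open>Both sides of the finite triple product identity vanish at \<open>z = -1\<close>; comparing their
  derivatives there gives Jacobi's identity.\<close>

lemma jacobi_cube_finite:
  "(\<Sum>k\<le>2 * Suc N. qbin fps_X (2 * Suc N) k * (fps_const (- (int k - int (Suc N)) * (-1) ^ nat \<bar>int k - int (Suc N)\<bar>)
      * fps_X ^ ztri (int k - int (Suc N)))) = euler_fin 1 N * euler_fin 1 (Suc N)"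
proof -
  let ?n = "Suc N"
  \<comment> \<open>The triple product without its factor 1 + z of index 0.\<close>
  define R :: "int fps poly" where
    "R = (\<Prod>j<N. 1 + [:0, 1:] * [:fps_X:] ^ Suc j) * (\<Prod>j<?n. [:0, 1:] + [:fps_X:] ^ Suc j)"
  define c :: "nat \<Rightarrow> int fps" where "c k = fps_X ^ ztri (int k - int ?n) * qbin fps_X (2 * ?n) k" for k
  have head: "1 + [:0, 1:] * [:fps_X :: int fps:] ^ 0 = [:1, 1:]"
    by (simp add: one_pCons)
  have "[:1, 1:] * R = (\<Prod>j<?n. (1 + [:0, 1:] * [:fps_X:] ^ j) * ([:0, 1:] + [:fps_X:] ^ Suc j))"
    unfolding R_def prod.distrib
    unfolding prod.lessThan_Suc_shift[of "\<lambda>j. 1 + [:0, 1:] * [:fps_X:] ^ j" N] head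
    by (simp only: mult_ac)
  also have "\<dots> = (\<Sum>k\<le>2 * ?n. [:fps_X:] ^ ztri (int k - int ?n) * qbin [:fps_X:] (2 * ?n) k * [:0, 1:] ^ k)"
    by (rule jacobi_triple_finite) simp
  also have "\<dots> = (\<Sum>k\<le>2 * ?n. monom (c k) k)"
    by (intro sum.cong refl)
       (simp add: c_def qbin_const_poly poly_const_pow monom_altdef mult.commute)
  finally have eq: "[:1, 1:] * R = (\<Sum>k\<le>2 * ?n. monom (c k) k)" .
  have "poly ([:1, 1:] * R) (-1) = 0" by simp
  then have zero: "(\<Sum>k\<le>2 * ?n. c k * (-1) ^ k) = 0"
    unfolding eq by (simp add: poly_sum poly_monom)
  have "poly (pderiv ([:1, 1:] * R)) (-1) = poly R (-1)"
    by (simp only: pderiv_mult poly_add poly_mult) (simp add: pderiv_pCons)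
  also have "poly R (-1) = euler_fin 1 N * ((-1) ^ ?n * euler_fin 1 ?n)"
  proof -
    have "poly (1 + [:0, 1:] * [:fps_X:] ^ Suc j) (-1) = (1 - fps_X ^ Suc j :: int fps)"
      "poly ([:0, 1:] + [:fps_X:] ^ Suc j) (-1) = (fps_X ^ Suc j - 1 :: int fps)" for j
      by (simp_all add: poly_const_pow)
    then show ?thesis
      by (simp only: R_def poly_mult poly_prod prod_linear_factors_fps prod_euler_fin_1)
  qed
  finally have "(\<Sum>k\<le>2 * ?n. of_nat k * c k * (-1) ^ (k - 1)) = (-1) ^ ?n * (euler_fin 1 N * euler_fin 1 ?n)"
    unfolding eq pderiv_sum pderiv_monom poly_sum poly_monom by (simp add: mult_ac)
  also have "(\<Sum>k\<le>2 * ?n. of_nat k * c k * (-1) ^ (k - 1)) = (\<Sum>k\<le>2 * ?n. of_int (- int k) * (c k * (-1) ^ k))"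
  proof (intro sum.cong refl)
    fix k show "of_nat k * c k * (-1) ^ (k - 1) = of_int (- int k) * (c k * (-1) ^ k)"
      by (cases k) (auto simp: algebra_simps)
  qed
  \<comment> \<open>A multiple of the vanishing sum \<open>zero\<close> is added to replace the
    weight k by k - (N + 1), centred at the middle index.\<close>
  also have "\<dots> = (\<Sum>k\<le>2 * ?n. of_int (- int k) * (c k * (-1) ^ k)) + of_nat ?n * (\<Sum>k\<le>2 * ?n. c k * (-1) ^ k)"
    unfolding zero by simp
  also have "\<dots> = (\<Sum>k\<le>2 * ?n. of_int (- (int k - int ?n)) * (c k * (-1) ^ k))"
    unfolding sum_distrib_left sum.distrib[symmetric]
    by (intro sum.cong refl) (simp add: algebra_simps)
  also have "\<dots> = (\<Sum>k\<le>2 * ?n. (-1) ^ ?n * (qbin fps_X (2 * ?n) k * (fps_const (- (int k - int ?n) * (-1) ^ nat \<bar>int k - int ?n\<bar>)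
      * fps_X ^ ztri (int k - int ?n))))"
  proof (intro sum.cong refl)
    fix k
    let ?i = "int k - int ?n"
    have "even (?n + nat \<bar>?i\<bar>) = even k" by (auto simp: even_nat_iff)
    then have "(-1 :: int fps) ^ k = (-1) ^ ?n * (-1) ^ nat \<bar>?i\<bar>"
      by (auto simp: minus_one_power_iff)
    moreover have "fps_const (- ?i) = (of_int (- ?i) :: int fps)"
      using fps_of_int[of "- ?i", where 'a = int] by (simp only: of_int_eq_id id_apply)
    then have "fps_const (- ?i * (-1) ^ nat \<bar>?i\<bar>) = of_int (- ?i) * (-1) ^ nat \<bar>?i\<bar>"
      by (simp only: fps_const_minus_one_power flip: fps_const_mult)
    ultimately show "of_int (- ?i) * (c k * (-1) ^ k) = (-1) ^ ?n * (qbin fps_X (2 * ?n) k *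
        (fps_const (- ?i * (-1) ^ nat \<bar>?i\<bar>) * fps_X ^ ztri ?i))"
      unfolding c_def by (simp only: mult_ac)
  qed
  finally show ?thesis
    unfolding sum_distrib_left[symmetric] by simp
qed

text \<open>The weight 2k + 1 arises as (k + 1) + k: the indices i = k + 1 and i = -k have the same
  triangular exponent.\<close>

theorem jacobi_cube: "jac = euler 1 ^ 3"
proof -
  define g :: "int \<Rightarrow> int fps" where "g i = fps_const (- i * (-1) ^ nat \<bar>i\<bar>) * fps_X ^ ztri i" for i
  have "(\<lambda>n. \<Sum>k\<le>2 * n. g (int k - int n)) \<longlonglongrightarrow> jac"
  proof -
    let ?p = "\<lambda>n. \<Sum>k<n. fps_const ((-1) ^ k * (int k + 1)) * fps_X ^ (Suc k choose 2) :: int fps"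
    let ?r = "\<lambda>n. \<Sum>k<n. fps_const ((-1) ^ k * int k) * fps_X ^ (Suc k choose 2) :: int fps"
    have "(\<Sum>k\<le>2 * n. g (int k - int n)) = ?p n + ?r (Suc n)" for n
    proof -
      have "(\<Sum>k\<le>2 * n. g (int k - int n)) =
          (\<Sum>k<n. fps_const ((-1) ^ k * (int k + 1)) * fps_X ^ (Suc k choose 2) +
            fps_const ((-1) ^ Suc k * int (Suc k)) * fps_X ^ (Suc (Suc k) choose 2))"
        unfolding sum_symmetric_int by (simp only: g_def ztri_pos ztri_neg) (simp add: nat_add_distrib algebra_simps)
      moreover have "?r (Suc n) = (\<Sum>k<n. fps_const ((-1) ^ Suc k * int (Suc k)) * fps_X ^ (Suc (Suc k) choose 2))"
        unfolding sum.lessThan_Suc_shift by simp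
      ultimately show ?thesis by (simp only: sum.distrib)
    qed
    moreover have "(\<lambda>n. ?p n + ?r (Suc n)) \<longlonglongrightarrow>
        sparse (\<lambda>k. (-1) ^ k * (int k + 1)) (\<lambda>k. Suc k choose 2) +
        sparse (\<lambda>k. (-1) ^ k * int k) (\<lambda>k. Suc k choose 2)"
      by (intro tendsto_add_fps LIMSEQ_Suc sparse_tendsto le_choose_two)
    moreover have "jac = sparse (\<lambda>k. (-1) ^ k * (int k + 1)) (\<lambda>k. Suc k choose 2) + sparse (\<lambda>k. (-1) ^ k * int k) (\<lambda>k. Suc k choose 2)"
      by (auto simp: jac_def sparse_def fps_eq_iff algebra_simps simp flip: sum.distrib intro!: sum.cong)
    ultimately show ?thesis by (simp only:)
  qed
  moreover have "fps_X ^ (nat \<bar>i\<bar> - 1) dvd g i" for i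
    unfolding g_def by (intro dvd_mult ztri_dvd)
  ultimately have "(\<lambda>n. \<Sum>k\<le>2 * n. euler_fin 1 n * qbin (fps_X ^ 1) (2 * n) k * g (int k - int n)) \<longlonglongrightarrow> jac"
    by (intro jacobi_triple_limit[where c = 1]) auto
  then have "(\<lambda>n. \<Sum>k\<le>2 * Suc n. euler_fin 1 (Suc n) * qbin (fps_X ^ 1) (2 * Suc n) k * g (int k - int (Suc n))) \<longlonglongrightarrow> jac"
    by (rule LIMSEQ_Suc)
  moreover have "(\<Sum>k\<le>2 * Suc n. euler_fin 1 (Suc n) * qbin (fps_X ^ 1) (2 * Suc n) k * g (int k - int (Suc n))) =
      euler_fin 1 (Suc n) * (euler_fin 1 n * euler_fin 1 (Suc n))" for n
    unfolding jacobi_cube_finite[symmetric] sum_distrib_left by (simp only: g_def mult.assoc power_one_right)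
  ultimately have "(\<lambda>n. euler_fin 1 (Suc n) * (euler_fin 1 n * euler_fin 1 (Suc n))) \<longlonglongrightarrow> jac"
    by (simp only:)
  moreover have "(\<lambda>n. euler_fin 1 (Suc n) * (euler_fin 1 n * euler_fin 1 (Suc n))) \<longlonglongrightarrow> (euler 1 * (euler 1 * euler 1) :: int fps)"
    by (intro tendsto_mult_fps euler_tendsto filterlim_ident filterlim_Suc) auto
  ultimately have "jac = euler 1 * (euler 1 * euler 1)"
    by (rule LIMSEQ_unique_fps)
  then show ?thesis by (simp add: power3_eq_cube mult_ac)
qed

section \<open>The bilateral series\<close>

text \<open>The terms of index \<open>n\<close> and \<open>-n\<close> of the bilateral series
  \<open>\<Sum> (a; q^2)_n / (b; q^2)_n z^n\<close> for \<open>a = -q\<close>, \<open>z = q\<close>, \<open>b = q^2 y\<close>.\<close>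

definition pos_term :: "rat fps \<Rightarrow> nat \<Rightarrow> rat fps" where
  "pos_term y n = fps_X ^ n * (\<Prod>j<n. 1 + fps_X ^ (2 * j + 1)) * inverse (\<Prod>j<n. 1 - y * fps_X ^ (2 * j + 2))"

definition neg_term :: "rat fps \<Rightarrow> nat \<Rightarrow> rat fps" where
  "neg_term y n = (\<Prod>j<n. fps_X ^ (2 * j) - y) * inverse (\<Prod>j<n. 1 + fps_X ^ (2 * j + 1))"

definition bilat :: "nat \<Rightarrow> rat fps \<Rightarrow> rat fps" where
  "bilat K y = (\<Sum>n<K. pos_term y n) + (\<Sum>n<K. neg_term y (Suc n))"

lemma pos_term_0 [simp]: "pos_term y 0 = 1"
  by (simp add: pos_term_def)

lemma neg_term_0 [simp]: "neg_term y 0 = 1"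
  by (simp add: neg_term_def)

lemma fps_inverse_prod_Suc:
  fixes f :: "nat \<Rightarrow> 'a::field fps"
  assumes "f n $ 0 \<noteq> 0"
  shows "inverse (\<Prod>j<Suc n. f j) * f n = inverse (\<Prod>j<n. f j)"
proof -
  have "inverse (\<Prod>j<Suc n. f j) * f n = inverse (\<Prod>j<n. f j) * (inverse (f n) * f n)"
    by (simp only: prod.lessThan_Suc fps_inverse_mult mult.assoc)
  then show ?thesis using inverse_mult_eq_1[OF assms] by simp
qed

section \<open>Functional equation of the bilateral series under y -> q^2 y\<close>

lemma pos_term_Suc:
  "pos_term y (Suc n) * (1 - y * fps_X ^ (2 * n + 2)) = pos_term y n * (fps_X * (1 + fps_X ^ (2 * n + 1)))"
proof -
  have *: "inverse (\<Prod>j<n. 1 - y * fps_X ^ (2 * j + 2)) =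
      inverse (\<Prod>j<Suc n. 1 - y * fps_X ^ (2 * j + 2)) * (1 - y * fps_X ^ (2 * n + 2))"
    by (rule fps_inverse_prod_Suc[symmetric]) simp
  show ?thesis
    unfolding pos_term_def * prod.lessThan_Suc[of "\<lambda>j. 1 + fps_X ^ (2 * j + 1)"] power_Suc
    by (simp only: mult_ac)
qed

lemma pos_term_shift:
  "pos_term (fps_X ^ 2 * y) n * (1 - y * fps_X ^ (2 * n + 2)) = pos_term y n * (1 - fps_X ^ 2 * y)"
proof -
  let ?f = "\<lambda>j. 1 - y * fps_X ^ (2 * j + 2) :: rat fps"
  have f: "?f n $ 0 \<noteq> 0" "?f 0 $ 0 \<noteq> 0" by auto
  have s: "(\<Prod>j<n. 1 - fps_X ^ 2 * y * fps_X ^ (2 * j + 2)) = (\<Prod>j<n. ?f (Suc j))"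
    by (intro prod.cong refl) (simp add: mult_ac power2_eq_square)
  have "inverse (\<Prod>j<n. ?f j) = inverse (\<Prod>j<Suc n. ?f j) * ?f n"
    by (rule fps_inverse_prod_Suc[symmetric, of ?f n]) (rule f)
  also have "\<dots> = inverse (?f 0) * inverse (\<Prod>j<n. ?f (Suc j)) * ?f n"
    unfolding prod.lessThan_Suc_shift by (simp only: fps_inverse_mult)
  finally have "inverse (\<Prod>j<n. ?f j) * ?f 0 = (inverse (?f 0) * ?f 0) * inverse (\<Prod>j<n. ?f (Suc j)) * ?f n"
    by (simp only: mult_ac)
  then have "inverse (\<Prod>j<n. ?f j) * ?f 0 = inverse (\<Prod>j<n. ?f (Suc j)) * ?f n"
    unfolding inverse_mult_eq_1[OF f(2)] by (simp only: mult_1)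
  moreover have "?f 0 = 1 - fps_X ^ 2 * y" by (simp add: power2_eq_square mult_ac)
  ultimately show ?thesis
    unfolding pos_term_def s by (simp only: mult.assoc)
qed

lemma neg_term_Suc:
  "neg_term y (Suc n) * (1 + fps_X ^ (2 * n + 1)) = neg_term y n * (fps_X ^ (2 * n) - y)"
proof -
  have *: "inverse (\<Prod>j<n. 1 + fps_X ^ (2 * j + 1)) =
      inverse (\<Prod>j<Suc n. 1 + fps_X ^ (2 * j + 1)) * (1 + fps_X ^ (2 * n + 1) :: rat fps)"
    by (rule fps_inverse_prod_Suc[symmetric]) simp
  show ?thesis
    unfolding neg_term_def * prod.lessThan_Suc[of "\<lambda>j. fps_X ^ (2 * j) - y"]
    by (simp only: mult_ac)
qed

text \<open>Past the leading factor 1 - q^2 y, every numerator factor on the left is q^2 times a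
  factor of \<open>neg_term y n\<close>; this produces q^(2n).\<close>

lemma neg_term_shift:
  "neg_term (fps_X ^ 2 * y) (Suc n) * (1 + fps_X ^ (2 * n + 1)) = (1 - fps_X ^ 2 * y) * fps_X ^ (2 * n) * neg_term y n"
proof (induction n)
  case 0
  show ?case using neg_term_Suc[of "fps_X ^ 2 * y" 0] by simp
next
  case (Suc n)
  let ?d = "1 + fps_X ^ (2 * n + 1) :: rat fps"
  have "?d $ 0 \<noteq> 0" by simp
  then have nz: "?d \<noteq> 0" by (metis fps_zero_nth)
  have "neg_term (fps_X ^ 2 * y) (Suc (Suc n)) * (1 + fps_X ^ (2 * Suc n + 1)) * ?d =
      neg_term (fps_X ^ 2 * y) (Suc n) * ?d * (fps_X ^ 2 * (fps_X ^ (2 * n) - y))"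
  proof -
    have "fps_X ^ (2 * Suc n) - fps_X ^ 2 * y = fps_X ^ 2 * (fps_X ^ (2 * n) - y)"
      by (simp add: power2_eq_square algebra_simps)
    then show ?thesis unfolding neg_term_Suc[of "fps_X ^ 2 * y" "Suc n"] by (simp only: mult_ac)
  qed
  also have "\<dots> = (1 - fps_X ^ 2 * y) * fps_X ^ (2 * n) * neg_term y n * (fps_X ^ 2 * (fps_X ^ (2 * n) - y))"
    by (simp only: Suc)
  also have "\<dots> = (1 - fps_X ^ 2 * y) * fps_X ^ (2 * Suc n) * neg_term y (Suc n) * ?d"
  proof -
    have "fps_X ^ (2 * Suc n) = fps_X ^ 2 * (fps_X :: rat fps) ^ (2 * n)"
      by (simp add: power2_eq_square)
    moreover have "(1 - fps_X ^ 2 * y) * fps_X ^ (2 * n) * neg_term y n * (fps_X ^ 2 * (fps_X ^ (2 * n) - y)) =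
        (1 - fps_X ^ 2 * y) * (fps_X ^ 2 * fps_X ^ (2 * n)) * (neg_term y n * (fps_X ^ (2 * n) - y))"
      by (simp only: mult_ac)
    ultimately show ?thesis by (simp only: neg_term_Suc[symmetric] mult.assoc)
  qed
  finally show ?case using nz by (simp only: mult_cancel_right) simp
qed

text \<open>A telescoping certificate: the combination of the terms at y and q^2 y that enters the
  functional equation is a difference of consecutive terms. It is checked after multiplication by
  the nonzero denominator factor \<open>?w\<close>.\<close>

lemma pos_term_recurrence:
  "(1 + y) * (1 - fps_X ^ 2 * y) * pos_term y n - (1 + fps_X * y) * pos_term (fps_X ^ 2 * y) n =
    - y * (1 - fps_X ^ 2 * y) * (pos_term y (Suc n) - pos_term y n)"
proof -
  let ?w = "1 - y * fps_X ^ (2 * n + 2)" and ?p = "pos_term y n" and ?q = "1 - fps_X ^ 2 * y"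
  have "?w $ 0 \<noteq> 0" by simp
  then have nz: "?w \<noteq> 0" by (metis fps_zero_nth)
  have "((1 + y) * ?q * ?p - (1 + fps_X * y) * pos_term (fps_X ^ 2 * y) n) * ?w =
      (1 + y) * ?q * ?p * ?w - (1 + fps_X * y) * (pos_term (fps_X ^ 2 * y) n * ?w)"
    by (simp only: left_diff_distrib mult.assoc)
  also have "\<dots> = ?q * ?p * ((1 + y) * ?w - (1 + fps_X * y))"
    unfolding pos_term_shift by (simp add: algebra_simps)
  also have "(1 + y) * ?w - (1 + fps_X * y) = - y * (fps_X * (1 + fps_X ^ (2 * n + 1)) - ?w)"
    by (simp add: algebra_simps)
  also have "?q * ?p * (- y * (fps_X * (1 + fps_X ^ (2 * n + 1)) - ?w)) =
      - y * ?q * (?p * (fps_X * (1 + fps_X ^ (2 * n + 1))) - ?p * ?w)"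
    by (simp only: right_diff_distrib mult_ac)
  also have "\<dots> = - y * ?q * (pos_term y (Suc n) - ?p) * ?w"
    unfolding pos_term_Suc[symmetric] by (simp only: left_diff_distrib mult.assoc)
  finally show ?thesis using nz by (simp only: mult_cancel_right) simp
qed

lemma neg_term_recurrence:
  "(1 + y) * (1 - fps_X ^ 2 * y) * neg_term y (Suc n) - (1 + fps_X * y) * neg_term (fps_X ^ 2 * y) (Suc n) =
    - y * (1 - fps_X ^ 2 * y) * (neg_term y n - neg_term y (Suc n))"
proof -
  let ?w = "1 + fps_X ^ (2 * n + 1) :: rat fps" and ?p = "neg_term y n" and ?q = "1 - fps_X ^ 2 * y" and ?z = "fps_X ^ (2 * n) :: rat fps"
  have "?w $ 0 \<noteq> 0" by simp
  then have nz: "?w \<noteq> 0" by (metis fps_zero_nth)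
  have "((1 + y) * ?q * neg_term y (Suc n) - (1 + fps_X * y) * neg_term (fps_X ^ 2 * y) (Suc n)) * ?w =
      (1 + y) * ?q * (neg_term y (Suc n) * ?w) - (1 + fps_X * y) * (neg_term (fps_X ^ 2 * y) (Suc n) * ?w)"
    by (simp only: left_diff_distrib mult.assoc)
  also have "\<dots> = ?q * ?p * ((1 + y) * (?z - y) - (1 + fps_X * y) * ?z)"
    unfolding neg_term_shift unfolding neg_term_Suc by (simp add: algebra_simps)
  also have "(1 + y) * (?z - y) - (1 + fps_X * y) * ?z = - y * (?w - (?z - y))"
    by (simp add: algebra_simps)
  also have "?q * ?p * (- y * (?w - (?z - y))) = - y * ?q * (?p * ?w - ?p * (?z - y))"
    by (simp add: algebra_simps)
  also have "\<dots> = - y * ?q * (?p - neg_term y (Suc n)) * ?w"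
    unfolding neg_term_Suc[symmetric] by (simp only: left_diff_distrib mult.assoc)
  finally show ?thesis using nz by (simp only: mult_cancel_right) simp
qed

text \<open>Both halves telescope, in opposite directions. Their inner ends cancel because both
  terms of index 0 are 1.\<close>

lemma bilat_recurrence:
  "(1 + y) * (1 - fps_X ^ 2 * y) * bilat K y - (1 + fps_X * y) * bilat K (fps_X ^ 2 * y) =
    - y * (1 - fps_X ^ 2 * y) * (pos_term y K - neg_term y K)"
proof (induction K)
  case 0
  then show ?case by (simp add: bilat_def)
next
  case (Suc K)
  let ?a = "(1 + y) * (1 - fps_X ^ 2 * y)" and ?b = "1 + fps_X * y" and ?c = "- y * (1 - fps_X ^ 2 * y)"
  let ?y = "fps_X ^ 2 * y"
  have "?a * bilat (Suc K) y - ?b * bilat (Suc K) ?y = (?a * bilat K y - ?b * bilat K ?y) +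
     (?a * pos_term y K - ?b * pos_term ?y K) + (?a * neg_term y (Suc K) - ?b * neg_term ?y (Suc K))"
    by (simp only: bilat_def sum.lessThan_Suc) (simp only: distrib_left add_diff_add diff_add_eq add_ac, simp)
  also have "\<dots> = ?c * (pos_term y (Suc K) - neg_term y (Suc K))"
    unfolding Suc.IH pos_term_recurrence neg_term_recurrence
    by (simp only: distrib_left[symmetric]) simp
  finally show ?case .
qed

lemma pos_term_dvd: "fps_X ^ n dvd pos_term y n"
  by (simp add: pos_term_def mult.assoc)

text \<open>The numerator factor of index 0 is 1 - q^r and brings no power of q when r > 0; the
  extra q^r, present as y in the boundary term of \<open>bilat_recurrence\<close>, makes up for it.
  For r = 0 that factor vanishes.\<close>

lemma neg_term_dvd: "fps_X ^ n dvd fps_X ^ r * neg_term (fps_X ^ r) n"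
proof (cases "r = 0 \<or> n = 0")
  case True
  then show ?thesis
    by (cases n) (auto simp: neg_term_def prod.lessThan_Suc_shift simp del: prod.lessThan_Suc)
next
  case False
  then obtain k where n: "n = Suc k" and r: "r > 0" by (cases n) auto
  have 1: "fps_X ^ 1 dvd (fps_X ^ r :: rat fps)"
    using r by (intro le_imp_power_dvd) simp
  have "(\<Prod>j<k. fps_X) dvd (\<Prod>j<k. fps_X ^ (2 * Suc j) - fps_X ^ r :: rat fps)"
    using 1 by (intro prod_dvd_prod dvd_diff) auto
  then have "fps_X ^ k dvd (\<Prod>j<n. fps_X ^ (2 * j) - fps_X ^ r :: rat fps)"
    unfolding n prod.lessThan_Suc_shift by simp
  then have "fps_X ^ (1 + k) dvd fps_X ^ r * (\<Prod>j<n. fps_X ^ (2 * j) - fps_X ^ r :: rat fps)"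
    unfolding power_add using 1 by (intro mult_dvd_mono)
  then show ?thesis
    unfolding neg_term_def n by (simp only: plus_1_eq_Suc mult.assoc[symmetric] dvd_mult2)
qed

lemma bilat_step:
  "fps_X ^ K dvd (1 + fps_X ^ r) * (1 - fps_X ^ (r + 2)) * bilat K (fps_X ^ r) - (1 + fps_X ^ (r + 1)) * bilat K (fps_X ^ (r + 2))"
proof -
  have "fps_X ^ K dvd - (1 - fps_X ^ 2 * fps_X ^ r) * (fps_X ^ r * pos_term (fps_X ^ r) K - fps_X ^ r * neg_term (fps_X ^ r) K)"
    by (intro dvd_mult dvd_diff neg_term_dvd pos_term_dvd)
  also have "\<dots> = - (fps_X ^ r) * (1 - fps_X ^ 2 * fps_X ^ r) * (pos_term (fps_X ^ r) K - neg_term (fps_X ^ r) K)"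
    by (simp add: algebra_simps)
  also have "\<dots> = (1 + fps_X ^ r) * (1 - fps_X ^ (r + 2)) * bilat K (fps_X ^ r) - (1 + fps_X ^ (r + 1)) * bilat K (fps_X ^ (r + 2))"
    unfolding bilat_recurrence[symmetric] by (simp add: power_add power2_eq_square mult_ac)
  finally show ?thesis .
qed

lemma bilat_iterate:
  "fps_X ^ K dvd (\<Prod>l<i. (1 + fps_X ^ (r + 2 * l)) * (1 - fps_X ^ (r + 2 * l + 2))) * bilat K (fps_X ^ r)
     - (\<Prod>l<i. 1 + fps_X ^ (r + 2 * l + 1)) * bilat K (fps_X ^ (r + 2 * i))"
proof (induction i)
  case 0
  then show ?case by simp
next
  case (Suc i)
  let ?A = "\<lambda>i. \<Prod>l<i. (1 + fps_X ^ (r + 2 * l)) * (1 - fps_X ^ (r + 2 * l + 2)) :: rat fps"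
  let ?B = "\<lambda>i. \<Prod>l<i. 1 + fps_X ^ (r + 2 * l + 1) :: rat fps"
  let ?a = "(1 + fps_X ^ (r + 2 * i)) * (1 - fps_X ^ (r + 2 * i + 2)) :: rat fps" and ?b = "1 + fps_X ^ (r + 2 * i + 1) :: rat fps"
  let ?S = "\<lambda>i. bilat K (fps_X ^ (r + 2 * i))"
  have "fps_X ^ K dvd ?a * (?A i * bilat K (fps_X ^ r) - ?B i * ?S i) + ?B i * (?a * ?S i - ?b * bilat K (fps_X ^ (r + 2 * i + 2)))"
    by (intro dvd_add dvd_mult Suc.IH bilat_step)
  also have "\<dots> = ?A (Suc i) * bilat K (fps_X ^ r) - ?B (Suc i) * ?S (Suc i)"
  proof -
    have "r + 2 * Suc i = r + 2 * i + 2" by simp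
    then show ?thesis
      by (simp only: prod.lessThan_Suc) (simp only: right_diff_distrib left_diff_distrib mult_ac, simp)
  qed
  finally show ?case .
qed

lemma X_power_dvd_prod_minus_1:
  fixes f :: "nat \<Rightarrow> 'a::comm_ring_1 fps"
  assumes "\<And>j. j < n \<Longrightarrow> fps_X ^ K dvd f j - 1"
  shows "fps_X ^ K dvd (\<Prod>j<n. f j) - 1"
  using assms
proof (induction n)
  case (Suc n)
  have "fps_X ^ K dvd ((\<Prod>j<n. f j) - 1) * f n + (f n - 1)"
    using Suc by (intro dvd_add dvd_mult2) auto
  then show ?case by (simp add: algebra_simps)
qed auto

lemma fps_prod_nth_0: "prod f A $ 0 = (\<Prod>x\<in>A. f x $ 0 :: 'a::comm_ring_1)"
  by (induction A rule: infinite_finite_induct) auto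

lemma pos_term_cong_0:
  assumes "fps_X ^ K dvd y"
  shows "fps_X ^ K dvd pos_term y n - pos_term 0 n"
proof -
  let ?P = "\<Prod>j<n. 1 - y * fps_X ^ (2 * j + 2)"
  have "fps_X ^ K dvd ?P - 1"
    using assms by (intro X_power_dvd_prod_minus_1) auto
  then have "fps_X ^ K dvd - (pos_term 0 n * inverse ?P) * (?P - 1)"
    by (intro dvd_mult)
  also have "\<dots> = pos_term 0 n * inverse ?P - pos_term 0 n * (inverse ?P * ?P)"
    by (simp only: right_diff_distrib mult_1_right mult_minus_left mult.assoc) simp
  also have "inverse ?P * ?P = 1"
    by (intro inverse_mult_eq_1) (simp add: fps_prod_nth_0)
  also have "pos_term 0 n * inverse ?P = pos_term y n"
    by (simp add: pos_term_def)
  finally show ?thesis by simp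
qed

lemma X_power_dvd_prod_diff:
  fixes f g :: "nat \<Rightarrow> 'a::comm_ring_1 fps"
  assumes "\<And>j. j < n \<Longrightarrow> fps_X ^ K dvd f j - g j"
  shows "fps_X ^ K dvd (\<Prod>j<n. f j) - (\<Prod>j<n. g j)"
  using assms
proof (induction n)
  case (Suc n)
  have "fps_X ^ K dvd ((\<Prod>j<n. f j) - (\<Prod>j<n. g j)) * f n + (\<Prod>j<n. g j) * (f n - g n)"
    using Suc by (intro dvd_add dvd_mult2 dvd_mult) auto
  then show ?case by (simp add: algebra_simps)
qed auto

lemma neg_term_cong_0:
  assumes "fps_X ^ K dvd y"
  shows "fps_X ^ K dvd neg_term y n - neg_term 0 n"
proof -
  have "fps_X ^ K dvd ((\<Prod>j<n. fps_X ^ (2 * j) - y) - (\<Prod>j<n. fps_X ^ (2 * j) - 0))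
      * inverse (\<Prod>j<n. 1 + fps_X ^ (2 * j + 1))"
    using assms by (intro dvd_mult2 X_power_dvd_prod_diff) auto
  then show ?thesis by (simp add: neg_term_def algebra_simps)
qed

lemma bilat_cong_0:
  assumes "fps_X ^ K dvd y"
  shows "fps_X ^ K dvd bilat L y - bilat L 0"
proof -
  have "bilat L y - bilat L 0 = (\<Sum>n<L. pos_term y n - pos_term 0 n) + (\<Sum>n<L. neg_term y (Suc n) - neg_term 0 (Suc n))"
    by (simp add: bilat_def sum_subtractf)
  then show ?thesis
    using assms by (auto intro!: dvd_add dvd_sum pos_term_cong_0 neg_term_cong_0)
qed

text \<open>After K steps y has become q^(r + 2K), which is 0 modulo q^K.\<close>

lemma bilat_to_0:
  "fps_X ^ K dvd (\<Prod>l<K. (1 + fps_X ^ (r + 2 * l)) * (1 - fps_X ^ (r + 2 * l + 2))) * bilat K (fps_X ^ r)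
     - (\<Prod>l<K. 1 + fps_X ^ (r + 2 * l + 1)) * bilat K 0"
proof -
  let ?B = "\<Prod>l<K. 1 + fps_X ^ (r + 2 * l + 1) :: rat fps"
  have "fps_X ^ K dvd fps_X ^ (r + 2 * K)"
    by (intro le_imp_power_dvd) simp
  then have "fps_X ^ K dvd ?B * (bilat K (fps_X ^ (r + 2 * K)) - bilat K 0)"
    by (intro dvd_mult bilat_cong_0)
  then show ?thesis
    using dvd_add[OF bilat_iterate[where K = K and i = K and r = r]] by (fastforce simp: right_diff_distrib)
qed

section \<open>The case y = 1: q-binomial theorem\<close>

lemma bilat_1: "bilat K 1 = (\<Sum>n<K. pos_term 1 n)"
  by (simp add: bilat_def neg_term_def prod.lessThan_Suc_shift del: prod.lessThan_Suc)

text \<open>The one-sided series at y = 1 with z = q^(2i+1) in place of z = q; increasing i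
  multiplies z by q^2.\<close>

definition qsum :: "nat \<Rightarrow> nat \<Rightarrow> rat fps" where
  "qsum K i = (\<Sum>n<K. pos_term 1 n * fps_X ^ (2 * i * n))"

text \<open>The functional equation of the q-binomial series in z. The certificate \<open>G\<close>
  carries the factor 1 - q^(2n), which vanishes at n = 0 and otherwise cancels the last denominator
  factor of the term.\<close>

lemma qsum_step: "fps_X ^ K dvd (1 - fps_X ^ (2 * i + 1)) * qsum K i - (1 + fps_X ^ (2 * i + 2)) * qsum K (Suc i)"
proof -
  define G where "G n = pos_term 1 n * fps_X ^ (2 * i * n) * (1 - fps_X ^ (2 * n))" for n
  have "(1 - fps_X ^ (2 * i + 1)) * (pos_term 1 n * fps_X ^ (2 * i * n)) -
      (1 + fps_X ^ (2 * i + 2)) * (pos_term 1 n * fps_X ^ (2 * Suc i * n)) = G n - G (Suc n)" for n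
  proof -
    have "G (Suc n) = (pos_term 1 (Suc n) * (1 - 1 * fps_X ^ (2 * n + 2))) * fps_X ^ (2 * i * n + 2 * i)"
      by (simp add: G_def power_add algebra_simps)
    also have "\<dots> = pos_term 1 n * fps_X * (1 + fps_X ^ (2 * n + 1)) * fps_X ^ (2 * i * n + 2 * i)"
      unfolding pos_term_Suc by (simp only: mult_ac)
    finally have GS: "G (Suc n) = \<dots>" .
    show ?thesis
      unfolding GS by (simp add: G_def power_add algebra_simps)
  qed
  then have "(1 - fps_X ^ (2 * i + 1)) * qsum K i - (1 + fps_X ^ (2 * i + 2)) * qsum K (Suc i) = (\<Sum>n<K. G n - G (Suc n))"
    by (simp only: qsum_def sum_distrib_left sum_subtractf[symmetric])
  also have "\<dots> = - G K"
    unfolding sum_lessThan_telescope' by (simp add: G_def)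
  finally show ?thesis
    using pos_term_dvd[of K 1] by (simp add: G_def dvd_mult2)
qed

lemma qsum_iterate:
  "fps_X ^ K dvd (\<Prod>l<i. 1 - fps_X ^ (2 * l + 1)) * qsum K 0 - (\<Prod>l<i. 1 + fps_X ^ (2 * l + 2)) * qsum K i"
proof (induction i)
  case (Suc i)
  let ?A = "\<lambda>i. \<Prod>l<i. 1 - fps_X ^ (2 * l + 1) :: rat fps" and ?B = "\<lambda>i. \<Prod>l<i. 1 + fps_X ^ (2 * l + 2) :: rat fps"
  have "fps_X ^ K dvd (1 - fps_X ^ (2 * i + 1)) * (?A i * qsum K 0 - ?B i * qsum K i) +
      ?B i * ((1 - fps_X ^ (2 * i + 1)) * qsum K i - (1 + fps_X ^ (2 * i + 2)) * qsum K (Suc i))"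
    by (intro dvd_add dvd_mult Suc.IH qsum_step)
  also have "\<dots> = ?A (Suc i) * qsum K 0 - ?B (Suc i) * qsum K (Suc i)"
    by (simp only: prod.lessThan_Suc) (simp add: algebra_simps)
  finally show ?case .
qed auto

text \<open>At z = q^(2K+1) only the term n = 0 survives modulo q^K, so K steps of the functional
  equation evaluate the series.\<close>

lemma q_binomial_special:
  "fps_X ^ K dvd (\<Prod>l<K. 1 - fps_X ^ (2 * l + 1)) * bilat K 1 - (\<Prod>l<K. 1 + fps_X ^ (2 * l + 2))"
proof (cases K)
  case (Suc k)
  have "qsum K K - 1 = (\<Sum>n<k. pos_term 1 (Suc n) * fps_X ^ (2 * K * Suc n))"
    unfolding qsum_def Suc sum.lessThan_Suc_shift by simp
  also have "fps_X ^ K dvd \<dots>"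
    by (intro dvd_sum dvd_mult le_imp_power_dvd) simp
  finally have "fps_X ^ K dvd (\<Prod>l<K. 1 + fps_X ^ (2 * l + 2)) * (qsum K K - 1)"
    by (rule dvd_mult)
  moreover have "qsum K 0 = bilat K 1" by (simp add: qsum_def bilat_1)
  ultimately show ?thesis
    using dvd_add[OF qsum_iterate[where K = K and i = K]] by (fastforce simp: right_diff_distrib)
qed auto

section \<open>Summation of B(q) + B(-q)\<close>

definition B_alt :: "nat \<Rightarrow> rat fps" where
  "B_alt n = B_term n oo (fps_const (-1) * fps_X)"

lemma B_alt_eq: "B_alt n = (- fps_X) ^ n * (\<Prod>j<n. 1 - fps_X ^ (2 * j + 1)) * inverse (\<Prod>j<Suc n. 1 + fps_X ^ (2 * j + 1))"
proof -
  let ?c = "fps_const (-1) * fps_X :: rat fps"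
  have c: "?c $ 0 = 0" by simp
  have m: "fps_X ^ (2 * j + 1) oo ?c = - (fps_X ^ (2 * j + 1))" for j
    by (simp add: fps_eq_iff fps_nth_compose_linear fps_X_power_nth del: power_Suc)
  let ?D = "\<Prod>j<Suc n. 1 - fps_X ^ (2*j+1) :: rat fps"
  have D0: "?D $ 0 \<noteq> 0" by (simp add: fps_prod_nth_0)
  have "?D oo ?c = (\<Prod>j<Suc n. 1 + fps_X ^ (2 * j + 1))"
    by (simp only: fps_compose_prod_distrib[OF c] fps_compose_sub_distrib fps_compose_1 m) simp
  moreover have "(\<Prod>j<n. 1 + fps_X ^ (2*j+1)) oo ?c = (\<Prod>j<n. 1 - fps_X ^ (2 * j + 1))"
    by (simp only: fps_compose_prod_distrib[OF c] fps_compose_add_distrib fps_compose_1 m) simp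
  moreover have "fps_X ^ n oo ?c = (- fps_X) ^ n"
    by (auto simp add: fps_eq_iff fps_nth_compose_linear fps_X_power_nth power_minus[of fps_X] minus_one_power_iff)
  moreover have "inverse ?D oo ?c = inverse (?D oo ?c)"
    by (rule fps_inverse_compose[OF c D0])
  ultimately show ?thesis
    unfolding B_alt_def B_term_def by (simp only: fps_compose_mult_distrib[OF c])
qed

lemma B_alt_nth: "B_alt n $ N = (-1) ^ N * B_term n $ N"
  by (simp add: B_alt_def fps_nth_compose_linear)

text \<open>For y = q the numerator factors q^(2j) - q with j \<ge> 1 are -q (1 - q^(2j-1)), so the
  term of index -(n+1) is the n-th summand of B(-q) times the factor 1 - q contributed by j =
  0.\<close>

lemma bilat_X: "bilat K fps_X = (1 - fps_X) * (\<Sum>n<K. B_term n + B_alt n)"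
proof -
  have 1: "pos_term fps_X n = (1 - fps_X) * B_term n" for n
  proof -
    let ?E = "\<Prod>j<n. 1 - fps_X * fps_X ^ (2 * j + 2) :: rat fps"
    have "(\<Prod>j<Suc n. 1 - fps_X ^ (2*j+1)) = (1 - fps_X) * ?E"
      unfolding prod.lessThan_Suc_shift by simp
    then have "B_term n = fps_X ^ n * (\<Prod>j<n. 1 + fps_X ^ (2*j+1)) * (inverse (1 - fps_X) * inverse ?E)"
      unfolding B_term_def by (simp only: fps_inverse_mult)
    then have "(1 - fps_X) * B_term n = fps_X ^ n * (\<Prod>j<n. 1 + fps_X ^ (2*j+1)) * ((inverse (1 - fps_X) * (1 - fps_X)) * inverse ?E)"
      by (simp only: mult_ac)
    also have "inverse (1 - fps_X) * (1 - fps_X) = (1 :: rat fps)"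
      by (rule inverse_mult_eq_1) simp
    finally show ?thesis by (simp only: pos_term_def mult_1_left)
  qed
  have 2: "neg_term fps_X (Suc n) = (1 - fps_X) * B_alt n" for n
  proof -
    have "(\<Prod>j<Suc n. fps_X ^ (2 * j) - fps_X) = (1 - fps_X) * (\<Prod>j<n. - fps_X * (1 - fps_X ^ (2 * j + 1) :: rat fps))"
      unfolding prod.lessThan_Suc_shift by (simp add: algebra_simps)
    also have "\<dots> = (1 - fps_X) * ((- fps_X) ^ n * (\<Prod>j<n. (1 - fps_X ^ (2 * j + 1))))"
      by (simp only: prod.distrib prod_constant card_lessThan)
    finally show ?thesis unfolding neg_term_def B_alt_eq by (simp only: mult.assoc)
  qed
  show ?thesis
    unfolding bilat_def 1 2 by (simp add: sum_distrib_left sum.distrib distrib_left)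
qed

definition B_even :: "rat fps" where
  "B_even = Abs_fps (\<lambda>N. if even N then b_coeff N else 0)"

lemma B_term_nth_eq_0: "N < n \<Longrightarrow> B_term n $ N = 0"
  by (simp add: B_term_def mult.assoc fps_X_power_mult_nth)

lemma B_sum_tendsto: "(\<lambda>K. \<Sum>n<K. B_term n + B_alt n) \<longlonglongrightarrow> 2 * B_even"
proof (rule tendsto_fpsI)
  fix N
  have "(\<Sum>n<K. B_term n + B_alt n) $ N = (2 * B_even) $ N" if "N < K" for K
  proof -
    have "(\<Sum>n<K. B_term n + B_alt n) $ N = (1 + (-1) ^ N) * (\<Sum>n<K. B_term n $ N)"
      by (simp add: fps_sum_nth B_alt_nth sum_distrib_left algebra_simps sum.distrib)
    also have "(\<Sum>n<K. B_term n $ N) = (\<Sum>n\<le>N. B_term n $ N)"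
      using that by (intro sum.mono_neutral_right) (auto intro: B_term_nth_eq_0)
    also have "(1 + (-1) ^ N) * \<dots> = (2 * B_even) $ N"
    proof -
      have "(2 * B_even) $ N = B_even $ N + B_even $ N" by (simp only: mult_2 fps_add_nth)
      then show ?thesis by (simp add: B_even_def b_coeff_def fps_sum_nth minus_one_power_iff)
    qed
    finally show ?thesis .
  qed
  then show "eventually (\<lambda>K. (\<Sum>n<K. B_term n + B_alt n) $ N = (2 * B_even) $ N) sequentially"
    by (intro eventually_mono[OF eventually_gt_at_top[of N]])
qed

text \<open>The series for \<open>y = q\<close> and for \<open>y = 1\<close> both reduce to the one for \<open>y = 0\<close>, and for \<open>y = 1\<close>
  the q-binomial theorem applies. The extra factors close to 1 complete the products.\<close>

lemma B_sum_cong: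
  "fps_X ^ K dvd (\<Sum>n<K. B_term n + B_alt n) * euler_fin 2 (2 * K) ^ 2 * euler_fin 2 K ^ 2
      * ((1 - fps_X ^ (2 * K + 1)) * (1 + fps_X ^ (2 * K))) - 2 * euler_fin 4 K ^ 5"
proof -
  define W where "W = (\<Sum>n<K. B_term n + B_alt n)"
  \<comment> \<open>As products of K factors: \<alpha> is (-q;q^2), \<beta> is (q;q^2),
    \<open>\<beta>'\<close> is (q^3;q^2), \<gamma> is (-q^2;q^2), \<delta> is (q^2;q^2) and \<tau>
    is (-1;q^2).\<close>
  define \<alpha> where "\<alpha> = (\<Prod>l<K. 1 + fps_X ^ (2 * l + 1) :: rat fps)"
  define \<beta> where "\<beta> = (\<Prod>l<K. 1 - fps_X ^ (2 * l + 1) :: rat fps)"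
  define \<beta>' where "\<beta>' = (\<Prod>l<K. 1 - fps_X ^ (2 * l + 3) :: rat fps)"
  define \<gamma> where "\<gamma> = (\<Prod>l<K. 1 + fps_X ^ (2 * l + 2) :: rat fps)"
  define \<delta> where "\<delta> = (\<Prod>l<K. 1 - fps_X ^ (2 * l + 2) :: rat fps)"
  define \<tau> where "\<tau> = (\<Prod>l<K. 1 + fps_X ^ (2 * l) :: rat fps)"
  have h1: "fps_X ^ K dvd \<alpha> * \<beta>' * ((1 - fps_X) * W) - \<gamma> * bilat K 0"
    using bilat_to_0[of K 1] bilat_X[of K]
    by (simp add: prod.distrib \<alpha>_def \<beta>'_def \<gamma>_def W_def numeral_3_eq_3)
  have h0: "fps_X ^ K dvd \<tau> * \<delta> * bilat K 1 - \<alpha> * bilat K 0"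
    using bilat_to_0[of K 0] by (simp add: prod.distrib \<alpha>_def \<tau>_def \<delta>_def)
  have hq: "fps_X ^ K dvd \<beta> * bilat K 1 - \<gamma>"
    using q_binomial_special[of K] by (simp add: \<beta>_def \<gamma>_def)
  \<comment> \<open>The multipliers are chosen to eliminate \<open>bilat K 0\<close> and
    \<open>bilat K 1\<close>.\<close>
  have "fps_X ^ K dvd \<alpha> * \<beta> * (\<alpha> * \<beta>' * ((1 - fps_X) * W) - \<gamma> * bilat K 0)
      - \<gamma> * \<beta> * (\<tau> * \<delta> * bilat K 1 - \<alpha> * bilat K 0) + \<gamma> * \<tau> * \<delta> * (\<beta> * bilat K 1 - \<gamma>)"
    by (intro dvd_add dvd_diff dvd_mult h0 h1 hq)
  also have "\<dots> = \<alpha> * \<beta> * (\<alpha> * ((1 - fps_X) * \<beta>')) * W - \<gamma> * \<gamma> * \<tau> * \<delta>"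
    by (simp add: algebra_simps)
  also have "(1 - fps_X) * \<beta>' = \<beta> * (1 - fps_X ^ (2 * K + 1))"
  proof -
    have "(1 - fps_X) * \<beta>' = (\<Prod>l<Suc K. 1 - fps_X ^ (2 * l + 1))"
      unfolding prod.lessThan_Suc_shift by (simp add: \<beta>'_def numeral_3_eq_3)
    then show ?thesis by (simp add: \<beta>_def)
  qed
  \<comment> \<open>The new factors turn every product into truncations of f_2 and f_4: 1 + q^(2K)
    shifts \<tau> to 2 \<gamma>, \<open>euler_fin 4 K\<close> completes \<alpha> \<beta>, and
    \<delta> completes \<gamma>.\<close>
  finally have "fps_X ^ K dvd (\<alpha> * \<beta> * (\<alpha> * (\<beta> * (1 - fps_X ^ (2 * K + 1)))) * W - \<gamma> * \<gamma> * \<tau> * \<delta>)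
      * ((1 + fps_X ^ (2 * K)) * (euler_fin 4 K ^ 2 * \<delta> ^ 2))"
    by (rule dvd_mult2)
  also have "\<dots> = W * (\<alpha> * \<beta> * euler_fin 4 K) ^ 2 * \<delta> ^ 2 * ((1 - fps_X ^ (2 * K + 1)) * (1 + fps_X ^ (2 * K)))
      - \<gamma> * \<gamma> * (\<tau> * (1 + fps_X ^ (2 * K))) * \<delta> * \<delta> ^ 2 * euler_fin 4 K ^ 2"
    by (simp add: algebra_simps power2_eq_square)
  also have "\<tau> * (1 + fps_X ^ (2 * K)) = 2 * \<gamma>"
    using prod.lessThan_Suc_shift[of "\<lambda>l. 1 + fps_X ^ (2 * l) :: rat fps" K]
    by (simp add: \<tau>_def \<gamma>_def)
  also have "\<alpha> * \<beta> * euler_fin 4 K = euler_fin 2 (2 * K)"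
  proof -
    have "\<alpha> * \<beta> = (\<Prod>l<K. 1 - fps_X ^ (2 * Suc (2 * l)))"
      unfolding \<alpha>_def \<beta>_def prod.distrib[symmetric]
    proof (intro prod.cong refl)
      fix l
      have "2 * Suc (2 * l) = (2 * l + 1) + (2 * l + 1)" by simp
      then show "(1 + fps_X ^ (2 * l + 1)) * (1 - fps_X ^ (2 * l + 1)) = (1 - fps_X ^ (2 * Suc (2 * l)) :: rat fps)"
        by (simp only: power_add[of _ "2 * l + 1" "2 * l + 1"]) (simp add: algebra_simps)
    qed
    then show ?thesis using odd_prod_euler_fin[where m = 2 and n = K and 'a = rat] by simp
  qed
  also have d: "\<delta> = euler_fin 2 K"
  proof -
    have "(\<Prod>l<n. 1 - fps_X ^ (2 * l + 2)) = (euler_fin 2 n :: rat fps)" for n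
      by (induction n) (simp_all add: euler_fin_Suc)
    then show ?thesis by (simp add: \<delta>_def)
  qed
  also have "\<gamma> * \<gamma> * (2 * \<gamma>) * euler_fin 2 K * euler_fin 2 K ^ 2 * euler_fin 4 K ^ 2 =
      2 * (\<gamma> * euler_fin 2 K) ^ 3 * euler_fin 4 K ^ 2"
    by (simp add: power2_eq_square power3_eq_cube mult_ac)
  also have "\<gamma> * euler_fin 2 K = euler_fin 4 K"
    using euler_fin_plus[where m = 2 and n = K and 'a = rat] by (simp add: \<gamma>_def)
  also have "2 * euler_fin 4 K ^ 3 * euler_fin 4 K ^ 2 = 2 * (euler_fin 4 K :: rat fps) ^ 5"
    by (simp add: mult.assoc flip: power_add)
  finally show ?thesis unfolding W_def .
qed

lemma B_even_euler: "B_even * euler 2 ^ 4 = euler 4 ^ 5"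
proof -
  have m: "(\<lambda>K. 1 - fps_X ^ (2 * K + 1) :: rat fps) \<longlonglongrightarrow> 1"
    by (rule tendsto_fps_transform[where c = 0, OF tendsto_const]) (auto intro!: le_imp_power_dvd simp del: power_Suc)
  have p: "(\<lambda>K. 1 + fps_X ^ (2 * K) :: rat fps) \<longlonglongrightarrow> 1"
    by (rule tendsto_fps_transform[where c = 0, OF tendsto_const]) (auto intro!: le_imp_power_dvd)
  have "(\<lambda>K. (\<Sum>n<K. B_term n + B_alt n) * euler_fin 2 (2 * K) ^ 2 * euler_fin 2 K ^ 2
      * ((1 - fps_X ^ (2 * K + 1)) * (1 + fps_X ^ (2 * K)))) \<longlonglongrightarrow> 2 * B_even * euler 2 ^ 2 * euler 2 ^ 2 * (1 * 1)"
    by (intro tendsto_mult_fps tendsto_power_fps euler_tendsto filterlim_twice filterlim_ident m p B_sum_tendsto) auto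
  moreover have "(\<lambda>K. 2 * euler_fin 4 K ^ 5) \<longlonglongrightarrow> (2 * euler 4 ^ 5 :: rat fps)"
    by (intro tendsto_mult_fps tendsto_power_fps euler_tendsto filterlim_ident tendsto_const) auto
  ultimately have "2 * B_even * euler 2 ^ 2 * euler 2 ^ 2 * (1 * 1) = 2 * euler 4 ^ 5"
    by (rule LIMSEQ_unique_fps_dvd[where c = 0]) (simp only: diff_zero B_sum_cong)
  then have "2 * (B_even * euler 2 ^ 4) = 2 * euler 4 ^ 5"
    by (simp add: mult.assoc flip: power_add)
  then show ?thesis by simp
qed

section \<open>Transfer to integer coefficients\<close>

lemma euler_compose_X_power:
  assumes "k > 0"
  shows "euler m oo fps_X ^ k = (euler (m * k) :: 'a::idom fps)"
proof (rule fps_ext)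
  fix N
  have k0: "(fps_X ^ k :: 'a fps) $ 0 = 0" using assms by simp
  have *: "euler_fin m N oo fps_X ^ k = (euler_fin (m * k) N :: 'a fps)"
    unfolding euler_fin_def
    by (simp add: fps_compose_prod_distrib[OF k0] fps_compose_sub_distrib fps_X_power_compose[OF k0] power_mult[symmetric] mult_ac)
  show "(euler m oo fps_X ^ k) $ N = (euler (m * k) :: 'a fps) $ N"
  proof (cases "m = 0")
    case False
    have "(euler m oo fps_X ^ k) $ N = (euler_fin m N oo fps_X ^ k :: 'a fps) $ N"
      using False by (simp add: fps_nth_compose_X_power euler_fin_nth_eq)
    then show ?thesis unfolding * by (simp add: euler_def)
  next
    case True
    have "euler_fin 0 n $ n = (if n = 0 then 1 else 0 :: 'a)" for n
      by (induction n) (auto simp: euler_fin_Suc)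
    then have "(euler 0 :: 'a fps) = 1" by (auto simp: fps_eq_iff euler_def)
    then show ?thesis using True by simp
  qed
qed

definition rat_fps :: "int fps \<Rightarrow> rat fps" where
  "rat_fps f = Abs_fps (\<lambda>n. of_int (f $ n))"

lemma rat_fps_nth [simp]: "rat_fps f $ n = of_int (f $ n)"
  by (simp add: rat_fps_def)

lemma rat_fps_mult: "rat_fps (f * g) = rat_fps f * rat_fps g"
  by (simp add: fps_eq_iff fps_mult_nth)

lemma rat_fps_1 [simp]: "rat_fps 1 = 1"
  by (simp add: fps_eq_iff)

lemma rat_fps_power: "rat_fps (f ^ k) = rat_fps f ^ k"
  by (induction k) (simp_all add: rat_fps_mult)

lemma rat_fps_euler [simp]: "rat_fps (euler m) = euler m"
proof -
  have "rat_fps (euler_fin m n) = euler_fin m n" for n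
    by (induction n) (auto simp: euler_fin_Suc rat_fps_mult fps_eq_iff fps_X_power_nth fps_mult_nth intro!: sum.cong)
  then show ?thesis by (auto simp: fps_eq_iff euler_def)
qed

text \<open>Division inside integer power series: f_1^4 has constant coefficient 1, whose inverse is
  the last argument.\<close>

definition b2 :: "int fps" where
  "b2 = euler 2 ^ 5 * fps_right_inverse (euler 1 ^ 4) 1"

lemma b2_euler: "b2 * euler 1 ^ 4 = euler 2 ^ 5"
proof -
  have "(euler 1 ^ 4 :: int fps) $ 0 = 1"
    by (simp add: fps_power_zeroth euler_def)
  then have "euler 1 ^ 4 * fps_right_inverse (euler 1 ^ 4) 1 = (1 :: int fps)"
    by (intro fps_right_inverse) simp
  then show ?thesis by (simp add: b2_def mult_ac)
qed

text \<open>Read in the variable q^2, \<open>B_even_euler\<close> is the equation solved by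
  \<open>b2\<close>; cancelling f_1^4 over the rationals identifies the two. This also makes b(2n)
  an integer.\<close>

lemma b_coeff_even: "b_coeff (2 * n) = of_int (b2 $ n)"
proof -
  define C :: "rat fps" where "C = Abs_fps (\<lambda>n. b_coeff (2 * n))"
  have X0: "(fps_X ^ 2 :: rat fps) $ 0 = 0" by simp
  have "B_even = C oo fps_X ^ 2"
    by (simp add: fps_eq_iff fps_nth_compose_X_power C_def B_even_def)
  then have "(C * euler 1 ^ 4) oo fps_X ^ 2 = euler 2 ^ 5 oo fps_X ^ 2"
    using B_even_euler euler_compose_X_power[of 2 1, where 'a = rat] euler_compose_X_power[of 2 2, where 'a = rat]
    by (simp add: fps_compose_mult_distrib[OF X0] fps_compose_power[OF X0, symmetric])
  then have "((C * euler 1 ^ 4) oo fps_X ^ 2) $ (2 * n) = (euler 2 ^ 5 oo fps_X ^ 2) $ (2 * n)" for n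
    by simp
  then have "C * euler 1 ^ 4 = euler 2 ^ 5"
    by (simp add: fps_eq_iff fps_nth_compose_X_power)
  also have "\<dots> = rat_fps (b2 * euler 1 ^ 4)"
    by (simp only: b2_euler rat_fps_power rat_fps_euler)
  also have "\<dots> = rat_fps b2 * euler 1 ^ 4"
    by (simp add: rat_fps_power rat_fps_mult)
  finally have "C = rat_fps b2"
    using euler_nonzero[of 1, where 'a = rat] by simp
  then have "C $ n = rat_fps b2 $ n" by simp
  then show ?thesis by (simp add: C_def)
qed

section \<open>Relations between the theta series\<close>

definition jac2 :: "int fps" where
  "jac2 = jac oo fps_X ^ 2"

lemma jac2_euler: "jac2 = euler 2 ^ 3"
proof -
  have "(fps_X ^ 2 :: int fps) $ 0 = 0" by simp
  then show ?thesis
    using euler_compose_X_power[of 2 1, where 'a = int]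
    by (simp add: jac2_def jacobi_cube fps_compose_power[symmetric])
qed

text \<open>After multiplication by f_2 both sides are f_2^4.\<close>

lemma phi_psi: "phi * psi ^ 2 = jac2"
proof -
  have "(phi * psi ^ 2) * euler 2 = jac2 * euler 2"
  proof -
    have "(phi * psi ^ 2) * euler 2 = psi ^ 2 * (phi * euler 2)" by (simp only: mult_ac)
    also have "\<dots> = (psi * euler 1) ^ 2" unfolding gauss_square by (simp only: power_mult_distrib)
    also have "\<dots> = jac2 * euler 2"
      unfolding gauss_triangular jac2_euler by (simp flip: power_mult add: eval_nat_numeral)
    finally show ?thesis .
  qed
  then show ?thesis using euler_nonzero[of 2, where 'a = int] by simp
qed

lemma b2_phi: "b2 * phi ^ 2 = jac2"
proof -
  have "(b2 * phi ^ 2) * euler 2 ^ 2 = b2 * (phi * euler 2) ^ 2"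
    by (simp only: power_mult_distrib mult_ac)
  also have "\<dots> = b2 * euler 1 ^ 4" unfolding gauss_square by (simp flip: power_mult)
  also have "\<dots> = jac2 * euler 2 ^ 2"
    unfolding b2_euler jac2_euler by (simp flip: power_add)
  finally show ?thesis using euler_nonzero[of 2, where 'a = int] by simp
qed

lemma a_coeff_eq: "a_coeff N = (phi ^ 2 * jac2) $ N"
proof -
  have ft: "f_trunc m N = euler_fin m N" for m
    by (simp add: f_trunc_def euler_fin_def)
  have cong: "\<forall>i\<le>N. (f * g) $ i = (f' * g') $ i"
    if "\<forall>i\<le>N. f $ i = f' $ i" "\<forall>i\<le>N. g $ i = g' $ i" for f g f' g' :: "int fps"
    using that by (auto simp: fps_mult_nth intro!: sum.cong)
  have e: "\<forall>i\<le>N. euler_fin m N $ i = (euler m :: int fps) $ i" if "m > 0" for m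
    using that by (simp add: euler_fin_nth_eq)
  have "\<forall>i\<le>N. (euler_fin 1 N ^ k) $ i = (euler 1 ^ k :: int fps) $ i" for k
  proof (induction k)
    case (Suc k)
    show ?case unfolding power_Suc by (intro cong e Suc) simp
  qed simp
  then have "\<forall>i\<le>N. (euler_fin 1 N ^ 4 * euler_fin 2 N) $ i = (euler 1 ^ 4 * euler 2 :: int fps) $ i"
    by (intro cong e) auto
  then have "a_coeff N = (euler 1 ^ 4 * euler 2) $ N"
    unfolding a_coeff_def ft by blast
  also have "euler 1 ^ 4 * euler 2 = phi ^ 2 * jac2"
  proof -
    have "euler 1 ^ 4 = (phi * euler 2) ^ 2" unfolding gauss_square by (simp flip: power_mult)
    then show ?thesis unfolding jac2_euler by (simp add: power_mult_distrib eval_nat_numeral mult_ac)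
  qed
  finally show ?thesis .
qed

lemma b2_phi_psi: "b2 * phi = psi ^ 2"
proof -
  have "(b2 * phi) * phi = psi ^ 2 * phi"
    using phi_psi b2_phi by (simp add: power2_eq_square mult_ac)
  moreover have "phi $ 0 = 1"
    by (simp add: phi_def sq_theta_def sparse_def)
  then have "phi \<noteq> 0" by auto
  ultimately show ?thesis by simp
qed

section \<open>Divisibility by 9\<close>

lemma inj_square_Suc: "inj (\<lambda>k::nat. (Suc k)\<^sup>2)"
  by (auto intro!: injI simp: power2_eq_iff_nonneg)

lemma inj_triangular: "inj (\<lambda>k::nat. Suc k choose 2)"
  by (intro strict_mono_imp_inj_on) (simp add: strict_mono_Suc_iff choose_two_Suc)

lemma sq_theta_nth_eq_0:
  assumes "\<not> (n > 0 \<and> is_nth_power 2 n)"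
  shows "sq_theta $ n = 0"
  using assms unfolding sq_theta_def by (intro sparse_nth_0) auto

lemma odd_sq_theta_nth: "odd (sq_theta $ n) \<longleftrightarrow> n > 0 \<and> is_nth_power 2 n"
proof
  assume "odd (sq_theta $ n)"
  then show "n > 0 \<and> is_nth_power 2 n" using sq_theta_nth_eq_0[of n] by fastforce
next
  assume n: "n > 0 \<and> is_nth_power 2 n"
  then obtain k where "n = k\<^sup>2" by (auto elim: is_nth_powerE)
  with n obtain j where "n = (Suc j)\<^sup>2" by (cases k) auto
  then have "sq_theta $ n = (-1) ^ Suc j"
    unfolding sq_theta_def using sparse_nth[OF inj_square_Suc le_square_Suc] by simp
  then show "odd (sq_theta $ n)" by simp
qed

lemma even_sq_theta_nth: "even (sq_theta $ n) \<longleftrightarrow> \<not> (n > 0 \<and> is_nth_power 2 n)"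
  using odd_sq_theta_nth[of n] by blast

lemma eight_triangular: "8 * (Suc k choose 2) + 1 = (2 * k + 1)\<^sup>2"
proof -
  have "int (8 * (Suc k choose 2) + 1) = int ((2 * k + 1)\<^sup>2)"
    using two_choose_two[of "Suc k"] by (simp add: power2_eq_square algebra_simps)
  then show ?thesis by (simp only: of_nat_eq_iff)
qed

lemma triangular_iff: "n \<in> range (\<lambda>k. Suc k choose 2) \<longleftrightarrow> is_nth_power 2 (8 * n + 1)"
proof
  assume "n \<in> range (\<lambda>k. Suc k choose 2)"
  then obtain k where "n = Suc k choose 2" by auto
  then show "is_nth_power 2 (8 * n + 1)" using eight_triangular[of k] by (simp add: is_nth_powerI)
next
  assume "is_nth_power 2 (8 * n + 1)"
  then obtain x where x: "8 * n + 1 = x\<^sup>2" by (auto elim: is_nth_powerE)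
  have "odd (x\<^sup>2)" unfolding x[symmetric] by simp
  then obtain k where "x = 2 * k + 1" by (auto elim: oddE)
  then have "8 * n + 1 = 8 * (Suc k choose 2) + 1" using x eight_triangular[of k] by simp
  then show "n \<in> range (\<lambda>k. Suc k choose 2)" by auto
qed

text \<open>Otherwise the square 8T + 1 would be 2 modulo 3.\<close>

lemma triangular_mod_3: "(Suc k choose 2) mod 3 \<noteq> 2"
proof
  assume "(Suc k choose 2) mod 3 = 2"
  then have "(8 * (Suc k choose 2) + 1) mod 3 = 2" by presburger
  moreover have "(2 * k + 1)\<^sup>2 mod 3 \<noteq> 2"
  proof -
    have "(2 * k + 1) mod 3 = 0 \<or> (2 * k + 1) mod 3 = 1 \<or> (2 * k + 1) mod 3 = 2" by presburger
    moreover have "(2 * k + 1)\<^sup>2 mod 3 = ((2 * k + 1) mod 3)\<^sup>2 mod 3" by (simp add: power_mod)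
    ultimately show ?thesis by (auto simp: power2_eq_square)
  qed
  ultimately show False unfolding eight_triangular by simp
qed

text \<open>Reducing r only inside the body lets residue classes simply add in
  \<open>supp3_mult\<close>.\<close>

definition supp3 :: "nat \<Rightarrow> int fps \<Rightarrow> bool" where
  "supp3 r f \<longleftrightarrow> (\<forall>n. n mod 3 \<noteq> r mod 3 \<longrightarrow> f $ n = 0)"

definition part3 :: "nat \<Rightarrow> int fps \<Rightarrow> int fps" where
  "part3 r f = Abs_fps (\<lambda>n. if n mod 3 = r then f $ n else 0)"

lemma supp3_part3: "supp3 r (part3 r f)" if "r < 3"
  using that by (simp add: supp3_def part3_def)

lemma supp3_mult:
  assumes "supp3 r f" "supp3 s g"
  shows "supp3 (r + s) (f * g)"
  unfolding supp3_def
proof (intro allI impI)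
  fix n assume n: "n mod 3 \<noteq> (r + s) mod 3"
  have zero: "f $ i * g $ (n - i) = 0" if "i \<le> n" for i
  proof (rule ccontr)
    assume "f $ i * g $ (n - i) \<noteq> 0"
    then have "i mod 3 = r mod 3" "(n - i) mod 3 = s mod 3"
      using assms by (auto simp: supp3_def)
    then have "(i + (n - i)) mod 3 = (r + s) mod 3" by (metis mod_add_eq)
    then show False using that n by simp
  qed
  show "(f * g) $ n = 0" unfolding fps_mult_nth by (intro sum.neutral ballI zero) simp
qed

lemma supp3_add: "supp3 r f \<Longrightarrow> supp3 r g \<Longrightarrow> supp3 r (f + g)"
  by (simp add: supp3_def)

lemma supp3_diff: "supp3 r f \<Longrightarrow> supp3 r g \<Longrightarrow> supp3 r (f - g)"
  by (simp add: supp3_def)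

lemma numeral_fps_mult_nth: "(numeral c * f) $ n = (numeral c * f $ n :: 'a::comm_ring_1)"
  by (simp add: fps_mult_left_const_nth flip: fps_const_mult add: numeral_fps_const)

lemma supp3_numeral: "supp3 r f \<Longrightarrow> supp3 r (numeral c * f)"
  by (simp add: supp3_def numeral_fps_mult_nth)

lemma supp3_cong: "supp3 r f \<Longrightarrow> r mod 3 = s mod 3 \<Longrightarrow> supp3 s f"
  by (simp add: supp3_def)

lemma supp3_nth: "supp3 r f \<Longrightarrow> n mod 3 \<noteq> r mod 3 \<Longrightarrow> f $ n = 0"
  by (simp add: supp3_def)

text \<open>Both theta series have only exponents congruent to 0 or 1 modulo 3. The missing residue
  class 1 of \<open>jac2\<close> turns \<open>phi_psi\<close> into \<open>P * Z = Y * A\<close>, which makes the class 2 part of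
  \<open>psi^2 / phi\<close> the multiple \<open>1 + 4 + 4\<close> of a single series.\<close>

theorem b2_dvd_9:
  assumes "M mod 3 = 2"
  shows "9 dvd b2 $ M"
proof -
  \<comment> \<open>The sign of Y is chosen so that phi = P - 2Y, to be completed to the difference
    of cubes P^3 - 8 Y^3.\<close>
  define P Y A Z where "P = part3 0 phi" and "Y = - part3 1 sq_theta" and "A = part3 0 psi" and "Z = part3 1 psi"
  have sP: "supp3 0 P" and sA: "supp3 0 A" and sZ: "supp3 1 Z"
    by (simp_all add: P_def A_def Z_def supp3_part3)
  have sY: "supp3 1 Y" by (simp add: Y_def supp3_def part3_def)
  have mod3: "n mod 3 = 0 \<or> n mod 3 = 1 \<or> n mod 3 = 2" for n :: nat by presburger
  have phi_nth: "phi $ n = (if n = 0 then 1 else 2 * sq_theta $ n)" for n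
    using sq_theta_nth_eq_0[of 0] by (simp add: phi_def numeral_fps_mult_nth)
  have phi: "phi = P - 2 * Y"
  proof (rule fps_ext)
    fix n
    have "sq_theta $ n = 0" if "n mod 3 = 2"
    proof (rule sq_theta_nth_eq_0, safe)
      assume "is_nth_power 2 n"
      then obtain k where "n = k\<^sup>2" by (auto elim: is_nth_powerE)
      moreover have "k\<^sup>2 mod 3 = (k mod 3)\<^sup>2 mod 3" by (simp add: power_mod)
      ultimately show False using that mod3[of k] by (auto simp: power2_eq_square)
    qed
    then show "phi $ n = (P - 2 * Y) $ n"
      using mod3[of n] by (auto simp: P_def Y_def part3_def phi_nth numeral_fps_mult_nth)
  qed
  have psi: "psi = A + Z"
  proof (rule fps_ext)
    fix n
    have "psi $ n = 0" if "n mod 3 = 2"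
      unfolding psi_def using that triangular_mod_3 by (intro sparse_nth_0) auto
    then show "psi $ n = (A + Z) $ n"
      using mod3[of n] by (auto simp: A_def Z_def part3_def)
  qed
  \<comment> \<open>An exponent of \<open>jac2\<close> is twice a triangular number; if it were 1
    modulo 3, the triangular number would be 2 modulo 3.\<close>
  have jac2_0: "jac2 $ n = 0" if "n mod 3 = 1" for n
  proof (cases "even n")
    case True
    then have "(n div 2) mod 3 = 2" using that by presburger
    then have "jac $ (n div 2) = 0"
      unfolding jac_def using triangular_mod_3 by (intro sparse_nth_0) auto
    then show ?thesis by (simp add: jac2_def fps_nth_compose_X_power)
  qed (simp add: jac2_def fps_nth_compose_X_power)
  note supps = supp3_mult supp3_add supp3_diff supp3_numeral sP sA sZ sY
  have PZ: "P * Z = Y * A"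
  proof -
    let ?D1 = "P * A * Z - Y * A * A"
    \<comment> \<open>Sorted by residue classes 0, 1 and 2; the middle part has to vanish.\<close>
    have eq: "jac2 = (P * A * A - 2 * (Y * Z * Z)) + 2 * ?D1 + (P * Z * Z - 4 * (Y * A * Z))"
      unfolding phi_psi[symmetric] phi psi by (simp add: algebra_simps power2_eq_square)
    have "supp3 0 (P * A * A)" "supp3 0 (Y * Z * Z)" "supp3 2 (P * Z * Z)" "supp3 2 (Y * A * Z)"
      "supp3 1 (P * A * Z)" "supp3 1 (Y * A * A)"
      by (rule supp3_cong, (rule supps)+, simp)+
    then have s0: "supp3 0 (P * A * A - 2 * (Y * Z * Z))" and s1: "supp3 1 ?D1"
      and s2: "supp3 2 (P * Z * Z - 4 * (Y * A * Z))"
      by (auto intro: supps)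
    have "?D1 = 0"
    proof (rule fps_ext)
      fix n
      show "?D1 $ n = 0 $ n"
      proof (cases "n mod 3 = 1")
        case True
        have "jac2 $ n = 2 * ?D1 $ n"
          unfolding eq using supp3_nth[OF s0, of n] supp3_nth[OF s2, of n] True
          by (simp only: fps_add_nth numeral_fps_mult_nth) simp
        then show ?thesis using jac2_0[OF True] by simp
      qed (use supp3_nth[OF s1, of n] in simp)
    qed
    then have "A * (P * Z - Y * A) = 0" by (simp add: algebra_simps)
    moreover have "A $ 0 = 1" by (simp add: A_def part3_def psi_def sparse_def)
    then have "A \<noteq> 0" by auto
    ultimately show ?thesis by simp
  qed
  \<comment> \<open>P^2 + 2PY + 4Y^2 turns the denominator phi into U, whose exponents are divisible
    by 3. V and V' collect the parts of class 0 and 1 of the new numerator.\<close>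
  define U where "U = P * P * P - 8 * (Y * Y * Y)"
  define V where "V = (A * A * P * P + 8 * (A * Z * Y * Y) + 2 * (Z * Z * P * Y))"
  define V' where "V' = 2 * (A * A * P * Y) + 2 * (A * Z * P * P) + 4 * (Z * Z * Y * Y)"
  have "b2 * U = (b2 * phi) * (P * P + 2 * (P * Y) + 4 * (Y * Y))"
    unfolding phi U_def by (simp add: algebra_simps)
  also have "\<dots> = V + V' + (4 * (Y * A) * (Y * A) + 4 * (Y * A) * (P * Z) + (P * Z) * (P * Z))"
    unfolding b2_phi_psi psi V_def V'_def by (simp add: algebra_simps power2_eq_square)
  also have "\<dots> = V + V' + 9 * (P * Z * (P * Z))"
    unfolding PZ[symmetric] by (simp add: algebra_simps)
  finally have bU: "b2 * U = V + V' + 9 * (P * Z * (P * Z))" .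
  have "supp3 0 (A * A * P * P)" "supp3 0 (A * Z * Y * Y)" "supp3 0 (Z * Z * P * Y)"
    "supp3 1 (A * A * P * Y)" "supp3 1 (A * Z * P * P)" "supp3 1 (Z * Z * Y * Y)"
    "supp3 0 (P * P * P)" "supp3 0 (Y * Y * Y)"
    by (rule supp3_cong, (rule supps)+, simp)+
  then have sV: "supp3 0 V" and sV': "supp3 1 V'" and sU: "supp3 0 U"
    unfolding V_def V'_def U_def by (auto intro: supps)
  have U0: "U $ 0 = 1"
    using sY by (simp add: U_def numeral_fps_mult_nth P_def part3_def phi_nth supp3_def)
  show ?thesis
    using assms
  \<comment> \<open>Since U has constant term 1 and does not mix residue classes, the class 2
    coefficients of \<open>b2\<close> are recovered from those of b2 * U alone.\<close>
  proof (induction M rule: less_induct)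
    case (less n)
    have "9 dvd (b2 * U) $ n"
      unfolding bU using supp3_nth[OF sV, of n] supp3_nth[OF sV', of n] less.prems
      by (simp add: numeral_fps_mult_nth)
    moreover have "9 dvd (\<Sum>i<n. b2 $ i * U $ (n - i))"
    proof (rule dvd_sum)
      fix i assume "i \<in> {..<n}"
      then have i: "i < n" by simp
      show "9 dvd b2 $ i * U $ (n - i)"
      proof (cases "i mod 3 = 2")
        case False
        then have "(n - i) mod 3 \<noteq> 0" using less.prems i by presburger
        then show ?thesis using supp3_nth[OF sU, of "n - i"] by simp
      qed (use less.IH i in auto)
    qed
    moreover have "(b2 * U) $ n = (\<Sum>i<n. b2 $ i * U $ (n - i)) + b2 $ n"
      using U0 by (simp add: fps_mult_nth atLeast0AtMost lessThan_Suc_atMost[symmetric])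
    ultimately show ?case by (simp add: dvd_add_right_iff)
  qed
qed

section \<open>Divisibility by 8\<close>

lemma numeral_dvd_fps_iff:
  "(numeral c :: int fps) dvd f \<longleftrightarrow> (\<forall>n. numeral c dvd f $ n)"
proof
  assume "numeral c dvd f"
  then show "\<forall>n. numeral c dvd f $ n" by (auto simp: numeral_fps_mult_nth elim!: dvdE)
next
  assume *: "\<forall>n. numeral c dvd f $ n"
  have "f = numeral c * Abs_fps (\<lambda>n. f $ n div numeral c)"
    using * by (simp add: fps_eq_iff numeral_fps_mult_nth)
  then show "numeral c dvd f" by (rule dvdI)
qed

text \<open>An odd constant term makes u invertible modulo 2.\<close>

lemma even_fps_mult_unit:
  fixes f u :: "int fps"
  assumes "2 dvd f * u" "odd (u $ 0)"
  shows "2 dvd f"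
proof -
  have "even (f $ n)" for n
  proof (induction n rule: less_induct)
    case (less n)
    have "even ((f * u) $ n)" using assms(1) by (simp add: numeral_dvd_fps_iff)
    moreover have "(f * u) $ n = (\<Sum>i<n. f $ i * u $ (n - i)) + f $ n * u $ 0"
      by (simp add: fps_mult_nth atLeast0AtMost lessThan_Suc_atMost[symmetric])
    moreover have "even (\<Sum>i<n. f $ i * u $ (n - i))"
      using less by (intro dvd_sum) auto
    ultimately show ?case using assms(2) by simp
  qed
  then show ?thesis by (simp add: numeral_dvd_fps_iff)
qed

lemma even_square_sum_diff:
  fixes x :: "'b \<Rightarrow> 'a::comm_ring_1"
  shows "2 dvd (\<Sum>i\<in>A. x i)\<^sup>2 - (\<Sum>i\<in>A. (x i)\<^sup>2)"
proof (induction A rule: infinite_finite_induct)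
  case (insert a A)
  have "(\<Sum>i\<in>insert a A. x i)\<^sup>2 - (\<Sum>i\<in>insert a A. (x i)\<^sup>2) =
      ((\<Sum>i\<in>A. x i)\<^sup>2 - (\<Sum>i\<in>A. (x i)\<^sup>2)) + 2 * (x a * (\<Sum>i\<in>A. x i))"
    using insert by (simp add: power2_eq_square algebra_simps)
  then show ?case using insert by (simp only:) (intro dvd_add, auto)
qed auto

text \<open>Frobenius modulo 2. A coefficient sees only a polynomial truncation, for which squaring
  is additive up to even cross terms, and squaring an integer keeps its parity.\<close>

lemma even_square_diff_compose:
  fixes f :: "int fps"
  shows "2 dvd f\<^sup>2 - (f oo fps_X ^ 2)"
  unfolding numeral_dvd_fps_iff
proof
  fix n
  define g where "g = (\<Sum>i\<le>n. fps_const (f $ i) * fps_X ^ i)"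
  have g: "g $ i = f $ i" if "i \<le> n" for i
    using that by (simp add: g_def fps_sum_nth fps_X_power_nth if_distrib cong: if_cong)
  have "2 dvd g\<^sup>2 - (\<Sum>i\<le>n. (fps_const (f $ i) * fps_X ^ i)\<^sup>2)"
    unfolding g_def by (rule even_square_sum_diff)
  then have "even ((g\<^sup>2) $ n - (\<Sum>i\<le>n. (fps_const (f $ i) * fps_X ^ i)\<^sup>2) $ n)"
    unfolding numeral_dvd_fps_iff by simp
  moreover have "(g\<^sup>2) $ n = (f\<^sup>2) $ n"
    by (auto simp: power2_eq_square fps_mult_nth g intro!: sum.cong)
  moreover have "(\<Sum>i\<le>n. (fps_const (f $ i) * fps_X ^ i)\<^sup>2) $ n = (\<Sum>i\<le>n. if n = 2 * i then (f $ i)\<^sup>2 else 0)"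
    by (auto simp: fps_sum_nth power_mult_distrib fps_X_power_nth fps_const_power simp flip: power_mult intro!: sum.cong)
  moreover have "even ((\<Sum>i\<le>n. if n = 2 * i then (f $ i)\<^sup>2 else 0) - (f oo fps_X ^ 2) $ n)"
  proof (cases "even n")
    case True
    then obtain k where k: "n = 2 * k" by (rule evenE)
    have "(\<Sum>i\<le>n. if n = 2 * i then (f $ i)\<^sup>2 else 0) = (\<Sum>i\<in>{k}. (f $ i)\<^sup>2)"
      using k by (intro sum.mono_neutral_cong_right) auto
    then show ?thesis by (simp add: fps_nth_compose_X_power k)
  qed (auto simp: fps_nth_compose_X_power intro!: dvd_sum)
  ultimately show "even ((f\<^sup>2 - (f oo fps_X ^ 2)) $ n)"
    by (simp add: algebra_simps)
qed

section \<open>Reduction modulo 8 to a parity\<close>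

definition theta_sum :: "int fps" where
  "theta_sum = sq_theta + sq_theta\<^sup>2"

lemma phi_square: "phi\<^sup>2 = 1 + 4 * theta_sum"
  by (simp add: phi_def theta_sum_def power2_eq_square algebra_simps)

lemma a_coeff_mod_8: "a_coeff M = jac2 $ M + 4 * (jac2 * theta_sum) $ M"
proof -
  have "phi\<^sup>2 * jac2 = jac2 + 4 * (jac2 * theta_sum)"
    unfolding phi_square by (simp add: algebra_simps)
  then show ?thesis by (simp add: a_coeff_eq numeral_fps_mult_nth)
qed

text \<open>First-order expansion of 1 / (1 + 4v): inserting the equation for \<open>b2\<close> into
  itself leaves an error with factor 16.\<close>

lemma b2_mod_8: "8 dvd b2 $ M - (jac2 $ M - 4 * (jac2 * theta_sum) $ M)"
proof -
  have "jac2 = b2 + 4 * (theta_sum * b2)"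
    unfolding b2_phi[symmetric] phi_square by (simp add: algebra_simps)
  then have "b2 = jac2 - 4 * (theta_sum * b2)" by (simp add: algebra_simps)
  then have "b2 = jac2 - 4 * (theta_sum * (jac2 - 4 * (theta_sum * b2)))" by simp
  also have "\<dots> = jac2 - 4 * (jac2 * theta_sum) + 16 * (theta_sum * theta_sum * b2)"
    by (simp add: algebra_simps)
  finally have "b2 $ M = (jac2 - 4 * (jac2 * theta_sum) + 16 * (theta_sum * theta_sum * b2)) $ M"
    by simp
  then show ?thesis by (simp add: numeral_fps_mult_nth)
qed

lemma jac2_nth_eq_0:
  assumes "\<not> is_nth_power 2 (4 * M + 1)"
  shows "jac2 $ M = 0"
proof (cases "even M")
  case True
  then have "M div 2 \<notin> range (\<lambda>k. Suc k choose 2)"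
    using assms unfolding triangular_iff by (auto elim!: evenE)
  then show ?thesis by (simp add: jac2_def jac_def fps_nth_compose_X_power sparse_nth_0)
qed (simp add: jac2_def fps_nth_compose_X_power)

text \<open>If 4M + 1 = (2k + 1)^2, then M is twice a triangular number and the coefficient there is
  2k + 1 up to sign.\<close>

lemma odd_jac2_nth: "odd (jac2 $ M) \<longleftrightarrow> is_nth_power 2 (4 * M + 1)"
proof
  assume "odd (jac2 $ M)"
  then show "is_nth_power 2 (4 * M + 1)" using jac2_nth_eq_0[of M] by fastforce
next
  assume sq: "is_nth_power 2 (4 * M + 1)"
  then obtain x where x: "4 * M + 1 = x\<^sup>2" by (auto elim: is_nth_powerE)
  have "odd (x\<^sup>2)" unfolding x[symmetric] by simp
  then obtain k where "x = 2 * k + 1" by (auto elim: oddE)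
  then have "M = 2 * (Suc k choose 2)" using x eight_triangular[of k] by simp
  then have "jac2 $ M = (-1) ^ k * (2 * int k + 1)"
    using sparse_nth[OF inj_triangular le_choose_two, where c = "\<lambda>k. (-1) ^ k * (2 * int k + 1)" and k = k]
    by (simp add: jac2_def jac_def fps_nth_compose_X_power)
  then show "odd (jac2 $ M)" by simp
qed

lemma nonsquare_if_a_coeff:
  assumes "a_coeff m mod 8 = 0"
  shows "\<not> is_nth_power 2 (4 * m + 1)"
proof -
  have "even (jac2 $ m)" using assms a_coeff_mod_8[of m] by presburger
  then show ?thesis unfolding odd_jac2_nth[symmetric] by simp
qed

lemma a_coeff_dvd_8_iff:
  assumes "\<not> is_nth_power 2 (4 * M + 1)"
  shows "8 dvd a_coeff M \<longleftrightarrow> even ((jac2 * theta_sum) $ M)"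
  unfolding a_coeff_mod_8 jac2_nth_eq_0[OF assms] by presburger

lemma b2_dvd_8:
  assumes "\<not> is_nth_power 2 (4 * M + 1)" "even ((jac2 * theta_sum) $ M)"
  shows "8 dvd b2 $ M"
  using b2_mod_8[of M] assms(2) unfolding jac2_nth_eq_0[OF assms(1)] by presburger

section \<open>Even index: logarithmic derivative modulo 2\<close>

lemma even_jac_psi: "2 dvd jac - psi"
proof -
  have "even (\<Sum>k\<le>n. (if (Suc k choose 2) = n then (-1) ^ k * (2 * int k + 1) - 1 else 0))" for n
    by (rule dvd_sum) auto
  moreover have "(jac - psi) $ n = (\<Sum>k\<le>n. (if (Suc k choose 2) = n then (-1) ^ k * (2 * int k + 1) - 1 else 0))" for n
    unfolding fps_sub_nth jac_def psi_def sparse_def fps_nth_Abs_fps sum_subtractf[symmetric]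
    by (intro sum.cong) auto
  ultimately show ?thesis unfolding numeral_dvd_fps_iff by (simp only:) simp
qed

lemma fps_XD_nth: "fps_XD f $ n = of_nat n * (f $ n :: 'a::comm_ring_1)"
  by (cases n) (simp_all add: fps_XD_def)

lemma fps_XD_mult: "fps_XD (f * g) = fps_XD f * g + f * fps_XD (g :: 'a::comm_ring_1 fps)"
  by (simp add: fps_XD_def algebra_simps)

lemma dvd_compose_X2:
  assumes "2 dvd (f :: int fps)"
  shows "2 dvd f oo fps_X ^ 2"
  using assms by (auto simp: numeral_dvd_fps_iff fps_nth_compose_X_power)

text \<open>Here s, p, w, t stand for \<open>sq_theta\<close>, \<open>psi\<close> and the images of
  \<open>psi\<close> and \<open>sq_theta\<close> under q d/dq, and c for w at q^2. Modulo 2 one has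
  w^2 = c, t = s + s^4, and c equals the differentiated product, so the left side vanishes. The
  right side factors because v = s + s^2 satisfies v^2 + v = s + s^4 modulo 2.\<close>

lemma quadratic_in_derivative:
  fixes s p w t c :: "'a::comm_ring_1"
  shows "(w\<^sup>2 - c) - ((t * p\<^sup>2 + (1 + 2 * s) * (p * w)) - c) + (t - (s + s ^ 4)) * p\<^sup>2
      + 2 * (s * p * w - w * p * (s + s\<^sup>2) + p\<^sup>2 * (s + s\<^sup>2 + s ^ 3 + s ^ 4))
    = (w - p * (s + s\<^sup>2)) * (w - p * (s + s\<^sup>2) - p)"
  by (simp add: power2_eq_square power3_eq_cube power4_eq_xxxx algebra_simps)

text \<open>Dividing the derivative of \<open>phi_psi\<close> by 2 gives modulo 2 a quadratic equation for the
  logarithmic derivative of \<open>psi\<close>; its root with vanishing constant term is \<open>theta_sum\<close>.\<close>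

lemma even_psi_theta_sum: "2 dvd fps_XD psi - psi * theta_sum"
proof -
  let ?s = sq_theta and ?v = theta_sum and ?w = "fps_XD psi" and ?q = "fps_X ^ 2 :: int fps"
  \<comment> \<open>Modulo 2 the derivative keeps just the odd squares; the even squares in s cancel
    against s(q^4).\<close>
  have s_nth: "even ((fps_XD ?s - (?s + (?s oo fps_X ^ 4))) $ n)" for n
  proof -
    have "is_nth_power 2 n \<longleftrightarrow> 4 dvd n \<and> is_nth_power 2 (n div 4)" if "even n"
    proof
      assume "is_nth_power 2 n"
      then obtain k where k: "n = k\<^sup>2" by (auto elim: is_nth_powerE)
      with that have "even k" by simp
      then obtain l where "k = 2 * l" by (rule evenE)
      then show "4 dvd n \<and> is_nth_power 2 (n div 4)" using k by (simp add: power_mult_distrib is_nth_powerI)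
    next
      assume "4 dvd n \<and> is_nth_power 2 (n div 4)"
      then obtain k where "n = 4 * k\<^sup>2" by (auto elim!: dvdE is_nth_powerE)
      then have "n = (2 * k)\<^sup>2" by (simp add: power_mult_distrib)
      then show "is_nth_power 2 n" by (rule is_nth_powerI)
    qed
    note quarter = this
    have pos: "n div 4 > 0 \<longleftrightarrow> n > 0" if "4 dvd n" using that by (auto elim!: dvdE)
    have eq: "(fps_XD ?s - (?s + (?s oo fps_X ^ 4))) $ n =
        (int n - 1) * ?s $ n - (if 4 dvd n then ?s $ (n div 4) else 0)"
      by (simp add: fps_XD_nth fps_nth_compose_X_power algebra_simps)
    show ?thesis
    proof (cases "even n")
      case True
      have "even (?s $ n) \<longleftrightarrow> even (if 4 dvd n then ?s $ (n div 4) else 0)"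
        using quarter[OF True] pos by (cases "4 dvd n") (simp_all only: even_sq_theta_nth if_True if_False, auto)
      then show ?thesis unfolding eq using True by simp
    next
      case False
      then have "\<not> 4 dvd n" by presburger
      then show ?thesis unfolding eq using False by simp
    qed
  qed
  have s4: "2 dvd fps_XD ?s - (?s + ?s ^ 4)"
  proof -
    have X0: "?q $ 0 = 0" by simp
    have c4: "(?s oo ?q) oo ?q = ?s oo fps_X ^ 4"
    proof (rule fps_ext)
      fix n
      show "((?s oo ?q) oo ?q) $ n = (?s oo fps_X ^ 4) $ n"
      proof (cases "4 dvd n")
        case True
        then obtain k where "n = 4 * k" by (rule dvdE)
        then show ?thesis by (simp add: fps_nth_compose_X_power)
      next
        case False
        then have "\<not> (even n \<and> even (n div 2))" by presburger
        then show ?thesis using False by (auto simp: fps_nth_compose_X_power)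
      qed
    qed
    have "2 dvd (fps_XD ?s - (?s + (?s oo fps_X ^ 4))) - ((?s\<^sup>2)\<^sup>2 - (?s\<^sup>2 oo ?q)) - ((?s\<^sup>2 - (?s oo ?q)) oo ?q)"
    proof (rule dvd_diff[OF dvd_diff])
      show "2 dvd fps_XD ?s - (?s + (?s oo fps_X ^ 4))"
        unfolding numeral_dvd_fps_iff by (intro allI s_nth)
    qed (rule even_square_diff_compose dvd_compose_X2[OF even_square_diff_compose])+
    also have "\<dots> = fps_XD ?s - (?s + ?s ^ 4)"
    proof -
      have "(?s\<^sup>2)\<^sup>2 = ?s ^ 4" by (simp flip: power_mult)
      then show ?thesis by (simp only: fps_compose_sub_distrib c4) simp
    qed
    finally show ?thesis .
  qed
  \<comment> \<open>Differentiation produces a factor 2 on both sides, from phi = 1 + 2s, from the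
    square and from q^2. Dividing it out is what yields information modulo 2.\<close>
  have "2 * (fps_XD ?s * psi\<^sup>2 + phi * (psi * ?w)) = fps_XD (phi * psi\<^sup>2)"
  proof -
    have "fps_XD phi = 2 * fps_XD ?s"
      by (auto simp: fps_eq_iff fps_XD_nth phi_def numeral_fps_mult_nth)
    then show ?thesis by (simp add: fps_XD_mult power2_eq_square algebra_simps)
  qed
  also have "\<dots> = 2 * (fps_XD jac oo ?q)"
    unfolding phi_psi jac2_def
    by (auto simp: fps_eq_iff fps_XD_nth fps_nth_compose_X_power numeral_fps_mult_nth elim!: evenE)
  finally have deriv: "fps_XD ?s * psi\<^sup>2 + phi * (psi * ?w) = fps_XD jac oo ?q"
    by (rule mult_left_cancel[THEN iffD1, rotated]) simp
  have wj: "2 dvd fps_XD jac - ?w"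
  proof -
    have "(fps_XD jac - ?w) $ n = int n * (jac - psi) $ n" for n
      by (simp add: fps_XD_nth right_diff_distrib)
    moreover have "even ((jac - psi) $ n)" for n
      using even_jac_psi unfolding numeral_dvd_fps_iff by blast
    ultimately show ?thesis unfolding numeral_dvd_fps_iff by (simp only: dvd_mult) simp
  qed
  have "2 dvd (fps_XD jac - ?w) oo ?q"
    by (rule dvd_compose_X2[OF wj])
  then have J: "2 dvd (fps_XD jac oo ?q) - (?w oo ?q)" by (simp add: fps_compose_sub_distrib)
  have "2 dvd (?w\<^sup>2 - (?w oo ?q)) - ((fps_XD jac oo ?q) - (?w oo ?q)) + (fps_XD ?s - (?s + ?s ^ 4)) * psi\<^sup>2
      + 2 * (?s * psi * ?w - ?w * psi * ?v + psi\<^sup>2 * (?s + ?s\<^sup>2 + ?s ^ 3 + ?s ^ 4))"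
    by (intro dvd_add dvd_diff dvd_mult2 J s4 even_square_diff_compose) auto
  also have "\<dots> = (?w - psi * ?v) * (?w - psi * ?v - psi)"
    unfolding deriv[symmetric] phi_def theta_sum_def by (rule quadratic_in_derivative)
  finally have "2 dvd (?w - psi * ?v) * (?w - psi * ?v - psi)" .
  \<comment> \<open>This factor has constant term -1, so it is a unit modulo 2 and the other factor
    must be even.\<close>
  moreover have "odd ((?w - psi * ?v - psi) $ 0)"
    using sq_theta_nth_eq_0[of 0]
    by (simp add: fps_XD_nth theta_sum_def power2_eq_square psi_def sparse_def)
  ultimately show ?thesis by (rule even_fps_mult_unit)
qed

text \<open>A series in q^2 does not mix even and odd exponents, so it passes through the extraction
  of even-indexed coefficients.\<close>

lemma even_part_compose_mult:
  fixes f g :: "int fps"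
  shows "((f oo fps_X ^ 2) * g) $ (2 * n) = (f * Abs_fps (\<lambda>k. g $ (2 * k))) $ n"
proof -
  let ?q = "fps_X ^ 2 :: int fps" and ?e = "Abs_fps (\<lambda>k. g $ (2 * k))" and ?o = "Abs_fps (\<lambda>k. g $ (2 * k + 1))"
  have X0: "?q $ 0 = 0" by simp
  have "g = (?e oo ?q) + fps_X * (?o oo ?q)"
    by (auto simp: fps_eq_iff fps_nth_compose_X_power elim!: evenE oddE)
  then have "(f oo ?q) * g = (f oo ?q) * ((?e oo ?q) + fps_X * (?o oo ?q))"
    by (rule arg_cong)
  also have "\<dots> = ((f * ?e) oo ?q) + fps_X * ((f * ?o) oo ?q)"
    by (simp only: fps_compose_mult_distrib[OF X0] distrib_left mult.left_commute)
  finally have "(f oo ?q) * g = ((f * ?e) oo ?q) + fps_X * ((f * ?o) oo ?q)" .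
  then show ?thesis by (simp add: fps_nth_compose_X_power)
qed

text \<open>For M = 2n the coefficient is that of q^n in jac times the series of even-indexed
  coefficients of v. Modulo 2 the latter is v again and jac is psi, so the derivative of psi
  appears, with coefficient n times that of psi. This vanishes because 8n + 1 = 4M + 1 is not a
  square.\<close>

lemma even_jac2_theta_sum_even:
  assumes "even M" "\<not> is_nth_power 2 (4 * M + 1)"
  shows "even ((jac2 * theta_sum) $ M)"
proof -
  obtain n where n: "M = 2 * n" using assms(1) by (rule evenE)
  let ?e = "Abs_fps (\<lambda>k. theta_sum $ (2 * k))"
  have T: "even (theta_sum $ k - (sq_theta $ k + (sq_theta oo fps_X ^ 2) $ k))" for k
  proof -
    have "theta_sum $ k - (sq_theta $ k + (sq_theta oo fps_X ^ 2) $ k) = (sq_theta\<^sup>2 - (sq_theta oo fps_X ^ 2)) $ k"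
      by (simp add: theta_sum_def)
    then show ?thesis using even_square_diff_compose[of sq_theta] by (simp only: numeral_dvd_fps_iff)
  qed
  have ev: "2 dvd ?e - theta_sum"
    unfolding numeral_dvd_fps_iff
  proof
    fix k :: nat
    \<comment> \<open>Modulo 2, v = s(q) + s(q^2). Its coefficients at 2k and at k share the summand
      s_k; the other summands agree because 2k is a square exactly when k is even and k/2 is a
      square.\<close>
    have "is_nth_power 2 (2 * k) \<longleftrightarrow> even k \<and> is_nth_power 2 (k div 2)"
    proof
      assume "is_nth_power 2 (2 * k)"
      then obtain r where r: "2 * k = r\<^sup>2" by (auto elim: is_nth_powerE)
      then have "even (r\<^sup>2)" by (metis dvd_triv_left)
      then obtain l where "r = 2 * l" by (auto elim: evenE)
      then have "k = 2 * l\<^sup>2" using r by (simp add: power_mult_distrib)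
      then show "even k \<and> is_nth_power 2 (k div 2)" by (simp add: is_nth_powerI)
    next
      assume "even k \<and> is_nth_power 2 (k div 2)"
      then obtain l where "k = 2 * l\<^sup>2" by (auto elim!: evenE is_nth_powerE)
      then have "2 * k = (2 * l)\<^sup>2" by (simp add: power_mult_distrib)
      then show "is_nth_power 2 (2 * k)" by (metis is_nth_powerI)
    qed
    then have "even (sq_theta $ (2 * k) - (sq_theta oo fps_X ^ 2) $ k)"
      by (auto simp: fps_nth_compose_X_power even_sq_theta_nth elim!: evenE)
    moreover have "(sq_theta oo fps_X ^ 2) $ (2 * k) = sq_theta $ k"
      by (simp add: fps_nth_compose_X_power)
    ultimately show "even ((?e - theta_sum) $ k)"
      using T[of k] T[of "2 * k"] by simp presburger
  qed
  have "2 dvd jac * (?e - theta_sum) + (jac - psi) * theta_sum - (fps_XD psi - psi * theta_sum)"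
    by (intro dvd_add dvd_diff dvd_mult dvd_mult2 ev even_jac_psi even_psi_theta_sum)
  also have "\<dots> = jac * ?e - fps_XD psi" by (simp add: algebra_simps)
  finally have "even ((jac * ?e) $ n - fps_XD psi $ n)" unfolding numeral_dvd_fps_iff by simp
  moreover have "psi $ n = 0"
    unfolding psi_def using assms(2) n by (intro sparse_nth_0) (simp add: triangular_iff)
  ultimately show ?thesis
    unfolding n jac2_def even_part_compose_mult by (simp add: fps_XD_nth)
qed

section \<open>Sums of two squares and divisors\<close>

lemma even_card_involution:
  assumes "finite S" "\<And>x. x \<in> S \<Longrightarrow> f x \<in> S" "\<And>x. x \<in> S \<Longrightarrow> f (f x) = x"
  shows "even (card S) \<longleftrightarrow> even (card {x\<in>S. f x = x})"
  using assms
proof (induction "card S" arbitrary: S rule: less_induct)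
  case less
  show ?case
  proof (cases "\<exists>x\<in>S. f x \<noteq> x")
    case False
    then have "{x\<in>S. f x = x} = S" by auto
    then show ?thesis by simp
  next
    case True
    then obtain x where x: "x \<in> S" "f x \<noteq> x" by auto
    let ?T = "S - {x, f x}"
    have "card S = card ?T + 2"
    proof -
      have "card {x, f x} = 2" using x by simp
      moreover have "card S = card ?T + card {x, f x}"
        using less.prems x card_Diff_subset[of "{x, f x}" S] card_mono[of S "{x, f x}"] by simp
      ultimately show ?thesis by simp
    qed
    moreover have "even (card ?T) \<longleftrightarrow> even (card {x\<in>?T. f x = x})"
    proof (rule less.hyps)
      show "card ?T < card S" using calculation by simp
      show "f y \<in> ?T" if "y \<in> ?T" for y
        using that less.prems(2,3) x by (metis DiffE DiffI insert_iff singletonD insertCI)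
    qed (use less.prems in auto)
    moreover have "{x\<in>?T. f x = x} = {x\<in>S. f x = x}"
      using x less.prems(3) by auto
    ultimately show ?thesis by simp
  qed
qed

text \<open>One divisor from each pair d, D/d when D is not a square; in this form they match the
  fixed points of \<open>zagier\<close>.\<close>

definition small_divisors :: "nat \<Rightarrow> nat set" where
  "small_divisors D = {d. d dvd D \<and> d\<^sup>2 < D}"

text \<open>An involution on the positive solutions of \<open>x^2 + 4yz = D\<close>: the boundary cases \<open>x = y - z\<close>
  and \<open>x = 2y\<close> do not occur for odd \<open>D\<close> that is not a square.\<close>

definition zagier :: "int \<times> int \<times> int \<Rightarrow> int \<times> int \<times> int" where
  "zagier = (\<lambda>(x, y, z).
    if x < y - z then (x + 2 * z, z, y - x - z)
    else if x < 2 * y then (2 * y - x, y, x - y + z)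
    else (x - 2 * y, x - y + z, y))"

text \<open>The solutions of x^2 + 4yz = D carry two involutions. Swapping y and z fixes the
  representations x^2 + 4y^2; \<open>zagier\<close> fixes the triples with x = y, which amount to
  factorisations D = x (x + 4z).\<close>

lemma card_two_squares:
  fixes D :: nat
  assumes D: "D mod 4 = 1" "\<not> is_nth_power 2 D"
  shows "even (card {(x, y). x > 0 \<and> y > 0 \<and> x\<^sup>2 + 4 * y\<^sup>2 = int D}) \<longleftrightarrow> even (card (small_divisors D))"
proof -
  define S where "S = {(x, y, z). x > 0 \<and> y > 0 \<and> z > 0 \<and> x\<^sup>2 + 4 * y * z = int D}"
  have nsq: "x\<^sup>2 \<noteq> int D" for x :: int
  proof
    assume "x\<^sup>2 = int D"
    then have "int ((nat \<bar>x\<bar>)\<^sup>2) = int D" by simp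
    then have "D = (nat \<bar>x\<bar>)\<^sup>2" by (simp only: of_nat_eq_iff)
    then show False using D(2) by (auto simp: is_nth_power_def)
  qed
  have Sx: "odd x" if "(x, y, z) \<in> S" for x y z
  proof
    assume "even x"
    then obtain k where "x = 2 * k" by (rule evenE)
    then have "int D = 4 * (k * k + y * z)" using that by (simp add: S_def power2_eq_square algebra_simps)
    then have "int D mod 4 = 0" by simp
    moreover have "int D mod 4 = 1" using D(1) by (metis of_nat_1 of_nat_mod of_nat_numeral)
    ultimately show False by simp
  qed
  have "S \<subseteq> {1..int D} \<times> {1..int D} \<times> {1..int D}"
  proof
    fix t assume "t \<in> S"
    then obtain x y z where t: "t = (x, y, z)" and *: "x > 0" "y > 0" "z > 0" "x\<^sup>2 + 4 * y * z = int D"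
      by (auto simp: S_def)
    have "x \<le> x * x" "y \<le> y * z" "z \<le> y * z" "0 < y * z" "0 \<le> x * x"
      using *(1-3) by simp_all
    moreover have "x * x + 4 * (y * z) = int D" using *(4) by (simp add: power2_eq_square)
    ultimately have "x \<le> int D" "y \<le> int D" "z \<le> int D" by linarith+
    then show "t \<in> {1..int D} \<times> {1..int D} \<times> {1..int D}"
      using * t by (auto simp: power2_eq_square)
  qed
  then have fin: "finite S" by (rule finite_subset) simp
  have z_in: "zagier t \<in> S" and z_inv: "zagier (zagier t) = t" if tS: "t \<in> S" for t
  proof -
    obtain x y z where t: "t = (x, y, z)" and *: "x > 0" "y > 0" "z > 0" "x\<^sup>2 + 4 * y * z = int D"
      using tS by (auto simp: S_def)
    have "odd x" using Sx tS t by simp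
    then have "x \<noteq> 2 * y" by auto
    moreover have "x \<noteq> y - z"
      using * nsq[of "y + z"] by (auto simp: power2_eq_square algebra_simps)
    ultimately consider "x < y - z" | "x > y - z" "x < 2 * y" | "x > 2 * y" by linarith
    then have "zagier t \<in> S \<and> zagier (zagier t) = t"
    proof cases
      case 1
      have "(x + 2 * z)\<^sup>2 + 4 * z * (y - x - z) = x\<^sup>2 + 4 * y * z"
        by (simp add: power2_eq_square algebra_simps)
      moreover have "zagier t = (x + 2 * z, z, y - x - z)" using 1 by (simp add: t zagier_def)
      ultimately show ?thesis using 1 * by (simp add: S_def t) (simp add: zagier_def)
    next
      case 2
      have "(2 * y - x)\<^sup>2 + 4 * y * (x - y + z) = x\<^sup>2 + 4 * y * z"
        by (simp add: power2_eq_square algebra_simps)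
      moreover have "zagier t = (2 * y - x, y, x - y + z)" using 2 by (simp add: t zagier_def)
      ultimately show ?thesis using 2 * by (simp add: S_def t) (simp add: zagier_def)
    next
      case 3
      have "(x - 2 * y)\<^sup>2 + 4 * (x - y + z) * y = x\<^sup>2 + 4 * y * z"
        by (simp add: power2_eq_square algebra_simps)
      moreover have "zagier t = (x - 2 * y, x - y + z, y)" using 3 * by (simp add: t zagier_def)
      ultimately show ?thesis using 3 * by (simp add: S_def t) (simp add: zagier_def)
    qed
    then show "zagier t \<in> S" "zagier (zagier t) = t" by auto
  qed
  have "even (card S) \<longleftrightarrow> even (card {t\<in>S. zagier t = t})"
    using fin z_in z_inv by (rule even_card_involution)
  moreover have "even (card S) \<longleftrightarrow> even (card {t\<in>S. (case t of (x, y, z) \<Rightarrow> (x, z, y)) = t})"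
    using fin by (rule even_card_involution) (auto simp: S_def mult_ac)
  moreover have "{t\<in>S. (case t of (x, y, z) \<Rightarrow> (x, z, y)) = t} =
      (\<lambda>(x, y). (x, y, y)) ` {(x, y). x > 0 \<and> y > 0 \<and> x\<^sup>2 + 4 * y\<^sup>2 = int D}"
    by (auto simp: S_def image_iff power2_eq_square)
  then have "card {t\<in>S. (case t of (x, y, z) \<Rightarrow> (x, z, y)) = t} =
      card {(x, y). x > 0 \<and> y > 0 \<and> x\<^sup>2 + 4 * y\<^sup>2 = int D}"
    by (simp only:) (rule card_image, auto simp: inj_on_def)
  moreover have "card {t\<in>S. zagier t = t} = card (small_divisors D)"
  proof -
    let ?h = "\<lambda>d. (int d, int d, (int (D div d) - int d) div 4)"
    have "{t\<in>S. zagier t = t} = ?h ` small_divisors D"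
    proof (intro equalityI subsetI)
      fix t assume t': "t \<in> {t\<in>S. zagier t = t}"
      then have "t \<in> S" by simp
      then obtain x y z where t: "t = (x, y, z)" and *: "x > 0" "y > 0" "z > 0" "x\<^sup>2 + 4 * y * z = int D"
        by (auto simp: S_def)
      have "zagier (x, y, z) = (x, y, z)" using t' t by simp
      moreover have "fst (zagier (x, y, z)) =
          (if x < y - z then x + 2 * z else if x < 2 * y then 2 * y - x else x - 2 * y)"
        by (simp add: zagier_def)
      ultimately have "x = (if x < y - z then x + 2 * z else if x < 2 * y then 2 * y - x else x - 2 * y)"
        by (simp only: fst_conv)
      \<comment> \<open>Only the middle branch can fix x: the first would need z = 0, the third y =
        0.\<close>
      then have "y = x" using *(2,3) by presburger
      then have eq: "int D = x * (x + 4 * z)" using *(4) by (simp add: power2_eq_square algebra_simps)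
      then have "int D = int (nat x * nat (x + 4 * z))" using *(1,3) by simp
      then have D': "D = nat x * nat (x + 4 * z)" by (simp only: of_nat_eq_iff)
      have "D div nat x = nat (x + 4 * z)" unfolding D' using *(1,3) by simp
      then have "t = ?h (nat x)" using *(1,3) by (simp add: t \<open>y = x\<close>)
      moreover have "nat x \<in> small_divisors D"
      proof -
        have "x * x < int D" unfolding eq using *(1,3) by simp
        then have "int ((nat x)\<^sup>2) < int D" using *(1) by (simp add: power2_eq_square)
        moreover have "nat x dvd D" unfolding D' by simp
        ultimately show ?thesis unfolding small_divisors_def of_nat_less_iff by simp
      qed
      ultimately show "t \<in> ?h ` small_divisors D" by blast
    next
      fix t assume "t \<in> ?h ` small_divisors D"
      then obtain d where t: "t = ?h d" and d: "d dvd D" "d\<^sup>2 < D" by (auto simp: small_divisors_def)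
      then obtain e where e: "D = d * e" by (auto elim: dvdE)
      have d0: "d > 0" using e D(1) by (cases "d = 0") auto
      have "d < e" using d(2) e d0 by (simp add: power2_eq_square)
      \<comment> \<open>From de = 1 modulo 4 the cofactors agree modulo 4, so (e - d) / 4 is an
        integer and can serve as z.\<close>
      have "d mod 4 = e mod 4"
      proof -
        have "d mod 4 = 0 \<or> d mod 4 = 1 \<or> d mod 4 = 2 \<or> d mod 4 = 3" 
             "e mod 4 = 0 \<or> e mod 4 = 1 \<or> e mod 4 = 2 \<or> e mod 4 = 3" by presburger+
        moreover have "(d mod 4) * (e mod 4) mod 4 = 1" using D(1) e by (simp add: mod_mult_eq)
        ultimately show ?thesis by auto
      qed
      then have "4 dvd e - d" using \<open>d < e\<close> mod_eq_dvd_iff_nat[of d e 4] by simp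
      then obtain z where z: "e - d = 4 * z" by (auto elim: dvdE)
      then have e': "e = d + 4 * z" "z > 0" using \<open>d < e\<close> by auto
      have "t = (int d, int d, int z)" using d0 by (simp add: t e e'(1))
      then show "t \<in> {t\<in>S. zagier t = t}"
        using d0 e' by (auto simp: S_def zagier_def e power2_eq_square algebra_simps)
    qed
    moreover have "inj_on ?h (small_divisors D)" by (auto simp: inj_on_def)
    ultimately show ?thesis by (simp add: card_image)
  qed
  ultimately show ?thesis by simp
qed

lemma finite_small_divisors: "D > 0 \<Longrightarrow> finite (small_divisors D)"
  by (rule finite_subset[of _ "{..D}"]) (auto simp: small_divisors_def dvd_imp_le)

lemma card_divisors_nonsquare:
  fixes D :: nat
  assumes "D > 0" "\<not> is_nth_power 2 D"
  shows "card {d. d dvd D} = 2 * card (small_divisors D)"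
proof -
  have "{d. d dvd D} = small_divisors D \<union> (\<lambda>d. D div d) ` small_divisors D"
  proof (intro equalityI subsetI)
    fix d assume "d \<in> {d. d dvd D}"
    then obtain e where e: "D = d * e" by (auto elim: dvdE)
    have "d \<noteq> e" using assms(2) e by (auto simp: is_nth_power_def power2_eq_square)
    then consider "d < e" | "e < d" by linarith
    then show "d \<in> small_divisors D \<union> (\<lambda>d. D div d) ` small_divisors D"
    proof cases
      case 1
      then show ?thesis using e assms(1) by (auto simp: small_divisors_def power2_eq_square)
    next
      case 2
      then have "e \<in> small_divisors D" "d = D div e"
        using e assms(1) by (auto simp: small_divisors_def power2_eq_square)
      then show ?thesis by blast
    qed
  qed (auto simp: small_divisors_def intro: div_dvd_iff_mult)
  moreover have "small_divisors D \<inter> (\<lambda>d. D div d) ` small_divisors D = {}"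
    using assms(1) by (auto simp: small_divisors_def power2_eq_square elim!: dvdE)
  moreover have "inj_on (\<lambda>d. D div d) (small_divisors D)"
    using assms(1)
    by (intro inj_on_inverseI[where g = "\<lambda>d. D div d"]) (auto simp: small_divisors_def elim!: dvdE)
  ultimately show ?thesis
    using finite_small_divisors[OF assms(1)] by (simp add: card_Un_disjoint card_image)
qed

lemma odd_card_divisors:
  fixes D :: nat
  assumes "D > 0"
  shows "odd (card {d. d dvd D}) \<longleftrightarrow> is_nth_power 2 D"
proof
  assume "odd (card {d. d dvd D})"
  then show "is_nth_power 2 D" using card_divisors_nonsquare[OF assms] by fastforce
next
  assume "is_nth_power 2 D"
  then obtain r where r: "D = r\<^sup>2" by (auto elim: is_nth_powerE)
  have "even (card {d. d dvd D}) \<longleftrightarrow> even (card {d\<in>{d. d dvd D}. D div d = d})"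
    using assms by (intro even_card_involution) (auto elim!: dvdE)
  also have "{d\<in>{d. d dvd D}. D div d = d} = {r}"
  proof (intro equalityI subsetI)
    fix d assume "d \<in> {d\<in>{d. d dvd D}. D div d = d}"
    then have "d * d = D" by (metis (mono_tags, lifting) dvd_mult_div_cancel mem_Collect_eq)
    then have "d\<^sup>2 = r\<^sup>2" using r by (simp add: power2_eq_square)
    then show "d \<in> {r}" by simp
  qed (use assms r in \<open>auto simp: power2_eq_square\<close>)
  finally show "odd (card {d. d dvd D})" by simp
qed

text \<open>A divisor is p^i with i \<le> e times a divisor of k, uniquely, since the multiplicity
  of p recovers i.\<close>

lemma card_divisors_prime_power_mult:
  fixes p k :: nat
  assumes "prime p" "\<not> p dvd k" "k > 0"
  shows "card {d. d dvd p ^ e * k} = (e + 1) * card {d. d dvd k}"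
proof -
  have cop: "coprime (p ^ i) d" if "d dvd k" for i d
    using assms that by (meson coprime_power_left_iff dvd_trans prime_imp_coprime)
  have "inj_on (\<lambda>(i, d). p ^ i * d) ({..e} \<times> {d. d dvd k})"
  proof (rule inj_onI, clarsimp)
    fix i d i' d' assume *: "d dvd k" "d' dvd k" "p ^ i * d = p ^ i' * d'"
    have m: "multiplicity p (p ^ i * d) = i" if "d dvd k" for i d
    proof -
      have "\<not> p dvd d" using that assms(2) dvd_trans by blast
      moreover have "d \<noteq> 0" using that assms(3) by auto
      ultimately show ?thesis
        using assms(1) by (simp add: prime_elem_multiplicity_mult_distrib not_dvd_imp_multiplicity_0)
    qed
    have "i = i'" using m[OF *(1), of i] m[OF *(2), of i'] *(3) by simp
    moreover have "p ^ i > 0" using prime_gt_0_nat[OF assms(1)] by simp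
    ultimately show "i = i' \<and> d = d'" using *(3) by (metis mult_left_cancel less_not_refl2)
  qed
  moreover have "(\<lambda>(i, d). p ^ i * d) ` ({..e} \<times> {d. d dvd k}) = {d. d dvd p ^ e * k}"
  proof (intro equalityI subsetI)
    fix x assume "x \<in> {d. d dvd p ^ e * k}"
    then obtain a b where "x = a * b" "a dvd p ^ e" "b dvd k"
      by (auto elim: dvd_productE)
    then show "x \<in> (\<lambda>(i, d). p ^ i * d) ` ({..e} \<times> {d. d dvd k})"
      using divides_primepow_nat[OF assms(1)] by force
  qed (auto intro!: mult_dvd_mono le_imp_power_dvd)
  ultimately have "card {d. d dvd p ^ e * k} = card ({..e} \<times> {d. d dvd k})"
    by (metis card_image)
  then show ?thesis by (simp add: card_cartesian_product)
qed

lemma odd_square_mod_8: "odd (x::nat) \<Longrightarrow> x\<^sup>2 mod 8 = 1"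
proof -
  assume "odd x"
  then obtain k where "x = 2 * k + 1" by (rule oddE)
  then have "x\<^sup>2 = 8 * (Suc k choose 2) + 1" using eight_triangular[of k] by simp
  then show ?thesis by presburger
qed

lemma nonsquare_if_mod_8:
  fixes D :: nat
  assumes "D mod 8 = 5"
  shows "\<not> is_nth_power 2 D"
proof
  assume "is_nth_power 2 D"
  then obtain x where x: "D = x\<^sup>2" by (auto elim: is_nth_powerE)
  have "odd D" using assms by presburger
  then have "odd x" using x by simp
  then show False using odd_square_mod_8[of x] assms x by simp
qed

text \<open>Modulo 2, v = s + s(q^2), and f_2^3 s(q^2) has no odd exponents. The odd terms of f_2^3
  s are indexed by i with 4i + 1 = x^2 and M - i = y^2, that is by positive solutions of x^2 + 4y^2
  = 4M + 1.\<close>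

lemma even_jac2_theta_sum_odd:
  assumes "odd M"
  shows "even ((jac2 * theta_sum) $ M) \<longleftrightarrow> even (card (small_divisors (4 * M + 1)))"
proof -
  let ?D = "4 * M + 1"
  have D: "?D mod 8 = 5" using assms by presburger
  have X0: "(fps_X ^ 2 :: int fps) $ 0 = 0" by simp
  have "2 dvd jac2 * (sq_theta\<^sup>2 - (sq_theta oo fps_X ^ 2))"
    by (intro dvd_mult even_square_diff_compose)
  also have "\<dots> = jac2 * theta_sum - jac2 * sq_theta - (jac * sq_theta oo fps_X ^ 2)"
    by (simp add: theta_sum_def jac2_def fps_compose_mult_distrib[OF X0] algebra_simps)
  finally have "even ((jac2 * theta_sum) $ M - (jac2 * sq_theta) $ M)"
    using assms unfolding numeral_dvd_fps_iff by (simp add: fps_nth_compose_X_power)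
  then have "even ((jac2 * theta_sum) $ M) \<longleftrightarrow> even ((jac2 * sq_theta) $ M)" by simp
  also have "(jac2 * sq_theta) $ M = (\<Sum>i\<le>M. jac2 $ i * sq_theta $ (M - i))"
    by (simp add: fps_mult_nth atLeast0AtMost)
  also have "even (\<Sum>i\<le>M. jac2 $ i * sq_theta $ (M - i)) \<longleftrightarrow>
      even (card {i\<in>{..M}. odd (jac2 $ i * sq_theta $ (M - i))})"
    by (rule even_sum_iff) simp
  also have "{i\<in>{..M}. odd (jac2 $ i * sq_theta $ (M - i))} =
      {i. i < M \<and> is_nth_power 2 (4 * i + 1) \<and> is_nth_power 2 (M - i)}"
    unfolding even_mult_iff even_sq_theta_nth de_Morgan_disj not_not odd_jac2_nth by auto
  also have "card \<dots> = card {(x, y). x > 0 \<and> y > 0 \<and> x\<^sup>2 + 4 * y\<^sup>2 = int ?D}"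
  proof -
    let ?F = "{(x, y). x > 0 \<and> y > 0 \<and> x\<^sup>2 + 4 * y\<^sup>2 = int ?D}"
    let ?h = "\<lambda>(x::int, y::int). nat ((x\<^sup>2 - 1) div 4)"
    have key: "\<exists>i. ?h (x, y) = i \<and> i < M \<and> x\<^sup>2 = int (4 * i + 1) \<and> y\<^sup>2 = int (M - i)"
      if "(x, y) \<in> ?F" for x y
    proof -
      have *: "x > 0" "y > 0" "x\<^sup>2 + 4 * y\<^sup>2 = 4 * int M + 1" using that by auto
      have "x\<^sup>2 > 0" "y\<^sup>2 > 0" using *(1,2) by simp_all
      then have "(x\<^sup>2 - 1) div 4 = int M - y\<^sup>2" "int M - y\<^sup>2 < int M" "int M - y\<^sup>2 \<ge> 0" using *(3) by linarith+
      note bounds = this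
      define i where "i = nat (int M - y\<^sup>2)"
      have "int i = int M - y\<^sup>2" using bounds(3) by (simp add: i_def)
      then have "i < M" "x\<^sup>2 = int (4 * i + 1)" "y\<^sup>2 = int (M - i)" using bounds(2) *(3) by linarith+
      moreover have "?h (x, y) = i" unfolding i_def bounds(1)[symmetric] by simp
      ultimately show ?thesis by blast
    qed
    have "{i. i < M \<and> is_nth_power 2 (4 * i + 1) \<and> is_nth_power 2 (M - i)} = ?h ` ?F"
    proof (intro equalityI subsetI)
      fix i assume "i \<in> {i. i < M \<and> is_nth_power 2 (4 * i + 1) \<and> is_nth_power 2 (M - i)}"
      then obtain x y where i: "i < M" and x: "4 * i + 1 = x\<^sup>2" and y: "M - i = y\<^sup>2"
        by (auto elim!: is_nth_powerE)
      have "x\<^sup>2 + 4 * y\<^sup>2 = ?D" using i x[symmetric] y[symmetric] by simp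
      then have "int (x\<^sup>2 + 4 * y\<^sup>2) = int ?D" by (simp only:)
      then have "(int x)\<^sup>2 + 4 * (int y)\<^sup>2 = int ?D" by simp
      moreover have "x > 0" "y > 0" using x y i by (auto intro!: gr0I)
      ultimately have "(int x, int y) \<in> ?F" by simp
      moreover have "int (4 * i + 1) = (int x)\<^sup>2" unfolding x by simp
      then have "i = ?h (int x, int y)" by simp
      ultimately show "i \<in> ?h ` ?F" by blast
    next
      fix i assume "i \<in> ?h ` ?F"
      then obtain x y where F: "(x, y) \<in> ?F" and i: "i = ?h (x, y)" by auto
      have *: "i < M" "x\<^sup>2 = int (4 * i + 1)" "y\<^sup>2 = int (M - i)" using key[OF F] i by auto
      have "int ((nat \<bar>x\<bar>)\<^sup>2) = int (4 * i + 1)" "int ((nat \<bar>y\<bar>)\<^sup>2) = int (M - i)" using *(2,3) by simp_all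
      then have "4 * i + 1 = (nat \<bar>x\<bar>)\<^sup>2" "M - i = (nat \<bar>y\<bar>)\<^sup>2" by (simp_all only: of_nat_eq_iff)
      then have "is_nth_power 2 (4 * i + 1)" "is_nth_power 2 (M - i)" by (auto intro: is_nth_powerI)
      then show "i \<in> {i. i < M \<and> is_nth_power 2 (4 * i + 1) \<and> is_nth_power 2 (M - i)}"
        using *(1) by blast
    qed
    moreover have "inj_on ?h ?F"
    proof (rule inj_onI)
      fix s t assume st: "s \<in> ?F" "t \<in> ?F" "?h s = ?h t"
      obtain x y x' y' where s: "s = (x, y)" and t: "t = (x', y')" by (cases s, cases t)
      have "\<exists>i. ?h s = i \<and> x\<^sup>2 = int (4 * i + 1) \<and> y\<^sup>2 = int (M - i)"
        "\<exists>i. ?h t = i \<and> x'\<^sup>2 = int (4 * i + 1) \<and> y'\<^sup>2 = int (M - i)"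
        using key[of x y] key[of x' y'] st(1,2) unfolding s t by blast+
      then have "x\<^sup>2 = x'\<^sup>2" "y\<^sup>2 = y'\<^sup>2" using st(3) by simp_all
      moreover have "x > 0" "y > 0" "x' > 0" "y' > 0" using st(1,2) by (simp_all add: s t)
      ultimately show "s = t" by (simp add: s t power2_eq_iff_nonneg)
    qed
    ultimately show ?thesis by (simp only: card_image)
  qed
  also have "even \<dots> \<longleftrightarrow> even (card (small_divisors ?D))"
    using D by (intro card_two_squares nonsquare_if_mod_8) presburger+
  finally show ?thesis .
qed

section \<open>Transfer from 4m + 1 to (3n)^2 (4m + 1)\<close>

lemma prime_dvd_powerful_part:
  fixes p k :: nat
  assumes "prime p" "multiplicity p k \<ge> 2"
  shows "p dvd powerful_part k"
proof -
  have "p \<in> prime_factors k"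
    using assms by (auto simp: prime_factors_multiplicity)
  then have "p ^ multiplicity p k dvd powerful_part k"
    unfolding powerful_part_def using assms(2) by (intro dvd_prodI) auto
  moreover have "p dvd p ^ multiplicity p k" using assms(2) by (intro dvd_power) auto
  ultimately show ?thesis by (rule dvd_trans[rotated])
qed

text \<open>If \<open>small_divisors (9 n^2 D)\<close> has odd size, then \<open>9 n^2 D = p^e r^2\<close> with \<open>p = 5\<close> modulo 8
  and \<open>e = 1\<close> modulo 4. In particular \<open>p \<noteq> 3\<close>, so the factor 9 is harmless, and the hypothesis
  on the powerful part keeps the exponent of \<open>p\<close> in \<open>D\<close> congruent to 1 modulo 4.\<close>

lemma even_card_small_divisors_mult:
  fixes D n :: nat
  assumes D: "D mod 8 = 5" and n: "odd n" "coprime n (powerful_part D)"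
    and even: "even (card (small_divisors D))"
  shows "even (card (small_divisors ((3 * n)\<^sup>2 * D)))"
proof (rule ccontr)
  define N where "N = 3 * n"
  define D' where "D' = N\<^sup>2 * D"
  assume "odd (card (small_divisors ((3 * n)\<^sup>2 * D)))"
  then have odd': "odd (card (small_divisors D'))" by (simp add: D'_def N_def)
  have N: "odd N" "N > 0" using n(1) by (auto simp: N_def intro!: gr0I)
  have D0: "D > 0" "odd D" using D by (auto intro!: gr0I, presburger)
  have "D' mod 8 = (N\<^sup>2 mod 8) * (D mod 8) mod 8" by (simp add: D'_def mod_mult_eq)
  then have D'8: "D' mod 8 = 5" using D odd_square_mod_8[OF N(1)] by simp
  have D'0: "D' > 0" "odd D'" using N D0 by (auto simp: D'_def)
  have nsq': "\<not> is_nth_power 2 D'" and nsq: "\<not> is_nth_power 2 D"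
    using nonsquare_if_mod_8 D D'8 by auto
  obtain p where p: "prime p" "odd (multiplicity p D')"
    using nsq' unfolding is_nth_power_conv_multiplicity_nat[OF zero_less_numeral] by auto
  define e' e f where "e' = multiplicity p D'" and "e = multiplicity p D" and "f = multiplicity p N"
  have e': "e' = 2 * f + e"
    using p(1) N D0 unfolding e'_def e_def f_def D'_def
    by (simp add: prime_elem_multiplicity_mult_distrib prime_elem_multiplicity_power_distrib)
  obtain K where K: "D = p ^ e * K" "\<not> p dvd K"
    unfolding e_def using D0 p(1) by (metis multiplicity_decompose' not_prime_unit less_not_refl2)
  obtain N0 where N0: "N = p ^ f * N0" "\<not> p dvd N0"
    unfolding f_def using N p(1) by (metis multiplicity_decompose' not_prime_unit less_not_refl2)
  have DK: "D' = p ^ e' * (N0\<^sup>2 * K)"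
    unfolding D'_def e' K(1) N0(1) by (simp add: power_mult_distrib power_add power_mult[symmetric] mult_ac)
  have pK: "\<not> p dvd N0\<^sup>2 * K"
    using K(2) N0(2) p(1) by (simp add: prime_dvd_mult_iff prime_dvd_power_iff)
  have pos: "K > 0" "N0\<^sup>2 * K > 0" using D0 K N N0 by (auto intro!: gr0I)
  have "card {d. d dvd D'} = (e' + 1) * card {d. d dvd N0\<^sup>2 * K}"
    unfolding DK using p(1) pK pos(2) by (rule card_divisors_prime_power_mult)
  then have c': "2 * card (small_divisors D') = (e' + 1) * card {d. d dvd N0\<^sup>2 * K}"
    using card_divisors_nonsquare[OF D'0(1) nsq'] by simp
  have "odd e'" using p(2) by (simp add: e'_def)
  then obtain j where j: "e' = 2 * j + 1" by (rule oddE)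
  have "card (small_divisors D') = (j + 1) * card {d. d dvd N0\<^sup>2 * K}"
    using c' by (simp add: j)
  then have "even j" "odd (card {d. d dvd N0\<^sup>2 * K})" using odd' by auto
  then have sq: "is_nth_power 2 (N0\<^sup>2 * K)" using odd_card_divisors[OF pos(2)] by simp
  \<comment> \<open>\<open>D'\<close> is p times an odd square, so p inherits the residue 5.\<close>
  have p8: "p mod 8 = 5"
  proof -
    obtain r where r: "N0\<^sup>2 * K = r\<^sup>2" using sq by (auto elim: is_nth_powerE)
    have "D' = p * (p ^ j * r)\<^sup>2"
      unfolding DK r j by (simp add: power_mult_distrib power_mult[symmetric] mult_ac)
    moreover from this have "odd (p ^ j * r)" using D'0(2) by auto
    then have "p * (p ^ j * r)\<^sup>2 mod 8 = p mod 8"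
      using odd_square_mod_8 mod_mult_right_eq[of p "(p ^ j * r)\<^sup>2" 8] by simp
    ultimately show ?thesis using D'8 by simp
  qed
  \<comment> \<open>If p does not divide N, then e = e'. Otherwise p divides n, the powerful part of
    D avoids p, and the odd exponent e can only be 1.\<close>
  have "e mod 4 = 1"
  proof (cases "f = 0")
    case True
    then show ?thesis using e' j \<open>even j\<close> by presburger
  next
    case False
    then have "p dvd N" unfolding f_def using not_dvd_imp_multiplicity_0[of p N] by auto
    moreover have "\<not> p dvd 3"
    proof
      assume "p dvd 3"
      then have "p \<le> 3" by (rule dvd_imp_le) simp
      then show False using p8 by simp
    qed
    ultimately have "p dvd n" using p(1) unfolding N_def by (auto dest: prime_dvd_multD)
    then have "\<not> p dvd powerful_part D"
      using coprime_common_divisor[OF n(2), of p] p(1) by auto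
    then have "e < 2" using prime_dvd_powerful_part[OF p(1), of D] unfolding e_def by (auto simp: not_less[symmetric])
    moreover have "odd e" using e' j by presburger
    ultimately have "e = 1" by presburger
    then show ?thesis by simp
  qed
  then have "\<exists>i. e = 4 * i + 1" by presburger
  then obtain i where i: "e = 4 * i + 1" by blast
  have "is_nth_power 2 K"
    using sq is_nth_power_mult_cancel_left[OF is_nth_power_nth_power[of 2 N0], of K] pos(2) by simp
  then have "odd (card {d. d dvd K})" using odd_card_divisors[OF pos(1)] by simp
  \<comment> \<open>Half of e + 1 is odd and K is a square, so D has an odd number of small
    divisors, against the hypothesis.\<close>
  moreover have "card (small_divisors D) = (2 * i + 1) * card {d. d dvd K}"
  proof -
    have "card {d. d dvd D} = (e + 1) * card {d. d dvd K}"
      unfolding K(1) using p(1) K(2) pos(1) by (rule card_divisors_prime_power_mult)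
    moreover have "e + 1 = 2 * (2 * i + 1)" using i by simp
    ultimately show ?thesis
      unfolding card_divisors_nonsquare[OF D0(1) nsq] by (simp only: mult.assoc mult_cancel_left) simp
  qed
  ultimately show False using even by simp
qed

theorem theorem1p14:
  fixes m n :: nat
  assumes "m > 0"
    and "a_coeff m mod 8 = 0"
    and "n \<ge> 1"
    and "coprime n (2 * powerful_part (4*m+1))"
  shows "\<exists>c::int. b_coeff (18*m*n^2 + (9*n^2 - 1) div 2) = 72 * of_int c"
proof -
  let ?D = "4 * m + 1"
  have n: "odd n" "coprime n (powerful_part ?D)"
    using assms(4) by simp_all
  obtain t where t: "n\<^sup>2 = 8 * t + 1"
    using odd_square_mod_8[OF n(1)] mult_div_mod_eq[of 8 "n\<^sup>2"] by metis
  \<comment> \<open>From n^2 = 8t + 1 one gets (9n^2 - 1) / 2 = 36t + 4, so M is half the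
    index.\<close>
  define M where "M = 9 * m * n\<^sup>2 + 18 * t + 2"
  have arg: "18 * m * n\<^sup>2 + (9 * n\<^sup>2 - 1) div 2 = 2 * M"
    by (simp add: M_def t)
  have D': "4 * M + 1 = (3 * n)\<^sup>2 * ?D"
    by (simp add: M_def t power_mult_distrib algebra_simps)
  have nsq: "\<not> is_nth_power 2 ?D"
    using assms(2) by (rule nonsquare_if_a_coeff)
  have nsq': "\<not> is_nth_power 2 (4 * M + 1)"
  proof
    assume "is_nth_power 2 (4 * M + 1)"
    moreover have "is_nth_power 2 ((3 * n)\<^sup>2)" by (rule is_nth_power_nth_power)
    moreover have "(3 * n)\<^sup>2 \<noteq> 0" using assms(3) by simp
    ultimately show False
      using nsq is_nth_power_mult_cancel_left[of 2 "(3 * n)\<^sup>2" ?D] unfolding D' by simp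
  qed
  have M3: "M mod 3 = 2"
  proof -
    have "M = 3 * (3 * m * n\<^sup>2 + 6 * t) + 2" by (simp add: M_def)
    then show ?thesis by presburger
  qed
  have par: "even M \<longleftrightarrow> even m"
    using n(1) by (simp add: M_def)
  have "even ((jac2 * theta_sum) $ M)"
  proof (cases "even m")
    case True
    then show ?thesis using par nsq' by (intro even_jac2_theta_sum_even) auto
  next
    case False
    have "8 dvd a_coeff m" using assms(2) by presburger
    then have "even (card (small_divisors ?D))"
      using a_coeff_dvd_8_iff[OF nsq] even_jac2_theta_sum_odd[OF False] by simp
    moreover have "?D mod 8 = 5" using False by presburger
    ultimately have "even (card (small_divisors (4 * M + 1)))"
      unfolding D' using n by (intro even_card_small_divisors_mult)
    then show ?thesis using even_jac2_theta_sum_odd[of M] False par by simp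
  qed
  then have "8 dvd b2 $ M" using nsq' by (intro b2_dvd_8)
  moreover have "9 dvd b2 $ M" using M3 by (rule b2_dvd_9)
  ultimately have "72 dvd b2 $ M" by presburger
  then obtain c where "b2 $ M = 72 * c" by (rule dvdE)
  then have "b_coeff (18 * m * n\<^sup>2 + (9 * n\<^sup>2 - 1) div 2) = 72 * of_int c"
    unfolding arg b_coeff_even by simp
  then show ?thesis by blast
qed

end
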